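(* Let $n\ge 3$ and let $F_n^2$ be the complex Leibniz algebra with basis $\{e_1,\dots,e_n\}$ and $[e_1,e_1]=e_3$, $[e_i,e_1]=e_{i+1}$ for $3\le i\le n-1$. Every three-dimensional non-split central extension of $F_n^2$ is isomorphic to one of the following pairwise non-isomorphic algebras (each with basis $\{e_1,\dots,e_{n+3}\}$): - $Q(0,0,0,1,0)$, $Q(1,0,0,1,0)$, $Q(0,0,0,1,1)$, $Q(1,0,0,1,1)$, $Q(0,0,1,1,\gamma_4)$ with $\gamma_4\in\mathbb{C}$, $Q(0,1,0,0,1)$, where $$Q(\alpha_4,\beta_3,\beta_4,\gamma_3,\gamma_4):\left\{\begin{array}{ll}[e_i,e_1]=e_{i+1},&1\le i\le n-1,\\ [e_{n+1},e_1]=e_{n+2},&\\ [e_1,e_{n+1}]=\beta_3e_{n+2}+\gamma_3e_{n+3},&\\ [e_{n+1},e_{n+1}]=\alpha_4e_n+\beta_4e_{n+2}+\gamma_4e_{n+3};&\end{array}\right.$$ - $$Q^*:\left\{\begin{array}{ll}[e_i,e_1]=e_{i+1},&1\le i\le n-2,\\ [e_n,e_1]=e_{n+1},&\\ [e_1,e_n]=e_{n+2},&\\ [e_n,e_n]=e_{n+3}.&\end{array}\right.$$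
   Context: All vector spaces and algebras are finite-dimensional over $\mathbb{C}$; parameters are complex numbers; in multiplication tables omitted products of basis elements are zero. A Leibniz algebra is an algebra $L$ with bilinear product satisfying $[x,[y,z]]=[[x,y],z]-[[x,z],y]$. A $k$-dimensional central extension of a Leibniz algebra $L$ is a Leibniz algebra $\widehat L$ fitting into a short exact sequence of Leibniz algebras $0\to V\to\widehat L\to L\to0$ with $\dim V=k$ and the image of $V$ contained in the center of $\widehat L$; equivalently $\widehat L\cong L\oplus V$ with product $[x+u,y+v]=[x,y]_L+\theta(x,y)$, where $\theta:L\times L\to V$ is bilinear with $\theta(x,[y,z])=\theta([x,y],z)-\theta([x,z],y)$. A $k$-dimensional central extension of $L$ is split if, as an algebra, it is isomorphic to $L'\oplus\mathbb{C}$, where $L'$ is a $(k-1)$-dimensional central extension of $L$ and $\mathbb{C}$ is the one-dimensional abelian algebra; otherwise it is non-split. *)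

theory Defs
  imports Complex_Main "HOL-Library.Function_Algebras" "HOL-Library.Product_Plus"
begin

section \<open>Finite-dimensional complex algebras\<close>

text \<open>
  An algebra lives on a subspace of an ambient complex vector space, so that algebras of
  arbitrary dimension can share one type. The zero and the addition are those of the type;
  nothing is assumed about the product outside the carrier.
\<close>

record 'a calg =
  carr :: "'a set"
  smul :: "complex \<Rightarrow> 'a \<Rightarrow> 'a"
  brk :: "'a \<Rightarrow> 'a \<Rightarrow> 'a"

locale fd_algebra = vector_space "smul A" for A :: "'a::ab_group_add calg" +
  assumes carr_subspace: "subspace (carr A)"
    and carr_fin_dim: "\<exists>B. finite B \<and> span B = carr A"
    and brk_closed: "\<lbrakk>x \<in> carr A; y \<in> carr A\<rbrakk> \<Longrightarrow> brk A x y \<in> carr A"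
    and brk_add_left: "\<lbrakk>x \<in> carr A; y \<in> carr A; z \<in> carr A\<rbrakk>
          \<Longrightarrow> brk A (x + y) z = brk A x z + brk A y z"
    and brk_add_right: "\<lbrakk>x \<in> carr A; y \<in> carr A; z \<in> carr A\<rbrakk>
          \<Longrightarrow> brk A x (y + z) = brk A x y + brk A x z"
    and brk_smul_left: "\<lbrakk>x \<in> carr A; y \<in> carr A\<rbrakk>
          \<Longrightarrow> brk A (smul A c x) y = smul A c (brk A x y)"
    and brk_smul_right: "\<lbrakk>x \<in> carr A; y \<in> carr A\<rbrakk>
          \<Longrightarrow> brk A x (smul A c y) = smul A c (brk A x y)"

locale leibniz_algebra = fd_algebra A for A :: "'a::ab_group_add calg" +
  assumes leibniz: "\<lbrakk>x \<in> carr A; y \<in> carr A; z \<in> carr A\<rbrakk>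
    \<Longrightarrow> brk A x (brk A y z) = brk A (brk A x y) z - brk A (brk A x z) y"

definition alg_dim :: "'a::ab_group_add calg \<Rightarrow> nat" where
  "alg_dim A = vector_space.dim (smul A) (carr A)"

definition alg_hom :: "'a::ab_group_add calg \<Rightarrow> 'b::ab_group_add calg \<Rightarrow> ('a \<Rightarrow> 'b) \<Rightarrow> bool" where
  "alg_hom A B f \<longleftrightarrow>
     f ` carr A \<subseteq> carr B \<and>
     (\<forall>x\<in>carr A. \<forall>y\<in>carr A. f (x + y) = f x + f y) \<and>
     (\<forall>c. \<forall>x\<in>carr A. f (smul A c x) = smul B c (f x)) \<and>
     (\<forall>x\<in>carr A. \<forall>y\<in>carr A. f (brk A x y) = brk B (f x) (f y))"

definition alg_iso :: "'a::ab_group_add calg \<Rightarrow> 'b::ab_group_add calg \<Rightarrow> bool"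
    (infix \<open>\<simeq>\<close> 50) where
  "A \<simeq> B \<longleftrightarrow> (\<exists>f. alg_hom A B f \<and> bij_betw f (carr A) (carr B))"

definition alg_center :: "'a::ab_group_add calg \<Rightarrow> 'a set" where
  "alg_center A = {x \<in> carr A. \<forall>y\<in>carr A. brk A x y = 0 \<and> brk A y x = 0}"

definition direct_sum :: "'a::ab_group_add calg \<Rightarrow> 'b::ab_group_add calg \<Rightarrow> ('a \<times> 'b) calg" where
  "direct_sum A B =
     \<lparr>carr = carr A \<times> carr B,
      smul = (\<lambda>c (x, y). (smul A c x, smul B c y)),
      brk = (\<lambda>(x, y) (x', y'). (brk A x x', brk B y y'))\<rparr>"

definition abelian_line :: "complex calg" where
  "abelian_line = \<lparr>carr = UNIV, smul = (*), brk = (\<lambda>x y. 0)\<rparr>"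

section \<open>Central extensions\<close>

text \<open>
  The kernel term \<open>V\<close> of the exact sequence, and the algebra \<open>L'\<close> in the definition of
  a split extension, are taken in the type of the extension \<open>E\<close>. This loses no generality:
  both embed linearly in \<open>E\<close>, so they have isomorphic copies on subspaces of \<open>carr E\<close>.
\<close>

definition central_extension ::
    "nat \<Rightarrow> 'a::ab_group_add calg \<Rightarrow> 'b::ab_group_add calg \<Rightarrow> bool" where
  "central_extension k E L \<longleftrightarrow>
     leibniz_algebra E \<and> leibniz_algebra L \<and>
     (\<exists>(V :: 'a calg) \<iota> \<pi>.
        leibniz_algebra V \<and> alg_dim V = k \<and>
        alg_hom V E \<iota> \<and> inj_on \<iota> (carr V) \<and>
        alg_hom E L \<pi> \<and> \<pi> ` carr E = carr L \<and>
        \<iota> ` carr V = {x \<in> carr E. \<pi> x = 0} \<and>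
        \<iota> ` carr V \<subseteq> alg_center E)"

definition split_extension ::
    "nat \<Rightarrow> 'a::ab_group_add calg \<Rightarrow> 'b::ab_group_add calg \<Rightarrow> bool" where
  "split_extension k E L \<longleftrightarrow>
     central_extension k E L \<and>
     (\<exists>m (L' :: 'a calg). k = Suc m \<and> central_extension m L' L \<and>
        E \<simeq> direct_sum L' abelian_line)"

definition nonsplit_extension ::
    "nat \<Rightarrow> 'a::ab_group_add calg \<Rightarrow> 'b::ab_group_add calg \<Rightarrow> bool" where
  "nonsplit_extension k E L \<longleftrightarrow> central_extension k E L \<and> \<not> split_extension k E L"

section \<open>Algebras given by multiplication tables\<close>

definition e :: "nat \<Rightarrow> nat \<Rightarrow> complex" where
  "e i = (\<lambda>k. if k = i then 1 else 0)"

definition scl :: "complex \<Rightarrow> (nat \<Rightarrow> complex) \<Rightarrow> (nat \<Rightarrow> complex)" (infixr \<open>\<cdot>\<close> 75) where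
  "c \<cdot> x = (\<lambda>k. c * x k)"

text \<open>\<open>table_algebra N T\<close> has basis \<open>e 1, \<dots>, e N\<close> and products \<open>[e i, e j] = T i j\<close>.\<close>

definition table_algebra ::
    "nat \<Rightarrow> (nat \<Rightarrow> nat \<Rightarrow> nat \<Rightarrow> complex) \<Rightarrow> (nat \<Rightarrow> complex) calg" where
  "table_algebra N T =
     \<lparr>carr = {x. \<forall>k. k \<notin> {1..N} \<longrightarrow> x k = 0},
      smul = scl,
      brk = (\<lambda>x y. \<Sum>i=1..N. \<Sum>j=1..N. (x i * y j) \<cdot> T i j)\<rparr>"

definition F2_algebra :: "nat \<Rightarrow> (nat \<Rightarrow> complex) calg" where
  "F2_algebra n = table_algebra n (\<lambda>i j.
     if i = 1 \<and> j = 1 then e 3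
     else if 3 \<le> i \<and> i \<le> n - 1 \<and> j = 1 then e (i + 1)
     else 0)"

type_synonym Q_param = "complex \<times> complex \<times> complex \<times> complex \<times> complex"

text \<open>The conditions in the two tables below are mutually exclusive for \<open>n \<ge> 3\<close>.\<close>

definition Q_algebra :: "nat \<Rightarrow> Q_param \<Rightarrow> (nat \<Rightarrow> complex) calg" where
  "Q_algebra n = (\<lambda>(\<alpha>4, \<beta>3, \<beta>4, \<gamma>3, \<gamma>4). table_algebra (n + 3) (\<lambda>i j.
     if 1 \<le> i \<and> i \<le> n - 1 \<and> j = 1 then e (i + 1)
     else if i = n + 1 \<and> j = 1 then e (n + 2)
     else if i = 1 \<and> j = n + 1 then \<beta>3 \<cdot> e (n + 2) + \<gamma>3 \<cdot> e (n + 3)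
     else if i = n + 1 \<and> j = n + 1 then \<alpha>4 \<cdot> e n + \<beta>4 \<cdot> e (n + 2) + \<gamma>4 \<cdot> e (n + 3)
     else 0))"

definition Q_star :: "nat \<Rightarrow> (nat \<Rightarrow> complex) calg" where
  "Q_star n = table_algebra (n + 3) (\<lambda>i j.
     if 1 \<le> i \<and> i \<le> n - 2 \<and> j = 1 then e (i + 1)
     else if i = n \<and> j = 1 then e (n + 1)
     else if i = 1 \<and> j = n then e (n + 2)
     else if i = n \<and> j = n then e (n + 3)
     else 0)"

definition Q_params :: "Q_param set" where
  "Q_params = {(0,0,0,1,0), (1,0,0,1,0), (0,0,0,1,1), (1,0,0,1,1), (0,1,0,0,1)}
     \<union> {(0,0,1,1,\<gamma>4) | \<gamma>4. True}"

end

theory Submission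
  imports Defs
begin

text \<open>
  The base algebra \<open>F2_algebra n\<close> has two generators: \<open>x = e 1\<close>, whose left powers
  \<open>x\<^sup>k = [x\<^sup>k\<^sup>-\<^sup>1, x]\<close> for \<open>k < n\<close> are linearly independent while \<open>x\<^sup>n = 0\<close>, and \<open>y = e 2\<close>, which
  multiplies everything to zero. In a central extension the Leibniz identity kills all further products
  of lifts of \<open>x\<close> and \<open>y\<close> except the four central elements \<open>x\<^sup>n\<close>, \<open>[y, x]\<close>, \<open>[x, y]\<close>, \<open>[y, y]\<close>; letting
  these be independent gives the \<open>(n + 4)\<close>-dimensional universal extension \<open>U\<close>.

  A non-split extension is generated by the lifts, because a central line outside the generated
  subalgebra would split off (\<open>nonsplit_extension_generated\<close>). So the three-dimensional ones are
  quotients of \<open>U\<close> by one linear relation \<open>p x\<^sup>n + q [y, x] + r [x, y] + s [y, y] = 0\<close>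
  between the four central elements (\<open>nonsplit_extension_presented\<close>), and each algebra of the list is
  such a quotient too (\<open>presented_by_Q_algebra\<close>, \<open>presented_by_Q_star\<close>).

  What remains is a classification of points \<open>(p : q : r : s)\<close> of projective three-space under
  changes of generators. Up to terms without influence on the relation, such a change is
  \<open>x \<mapsto> a x + b y\<close>, \<open>y \<mapsto> c y + d x\<^sup>n\<^sup>-\<^sup>1\<close> with \<open>a, c \<noteq> 0\<close>, and its effect is
  \<open>(p, q, r, s) \<mapsto> (a\<^sup>n p + a d q, a c q, a c r, b c (q + r) + c\<^sup>2 s)\<close>.
  Relations in the same orbit give isomorphic quotients (\<open>presented_by_transform\<close>,
  \<open>presented_by_unique\<close>), and conversely two presentations of one algebra have relations in the same
  orbit (\<open>presented_by_transform_exists\<close>, \<open>presented_by_top_power_relation\<close>). The point \<open>(1 : 0 : 0 : 0)\<close> is an orbit by itself; it is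
  \<open>Q_star\<close>, the only case with \<open>x\<^sup>n = 0\<close>. On the other points \<open>q\<close> and \<open>r\<close> vanish or not
  independently of the change, \<open>r / q\<close> is an invariant, \<open>d\<close> removes \<open>p\<close> when \<open>q \<noteq> 0\<close>, and \<open>b\<close> adjusts
  \<open>s\<close> when \<open>q + r \<noteq> 0\<close>; the orbits are represented by the parameters in \<open>Q_params\<close>, each once
  (\<open>transform_normal_form\<close>, \<open>transform_Q_relation_unique\<close>).
\<close>

section \<open>Quotients and central extensions of algebras\<close>

lemma alg_homD:
  assumes "alg_hom A B f"
  shows "x \<in> carr A \<Longrightarrow> f x \<in> carr B"
    and "x \<in> carr A \<Longrightarrow> y \<in> carr A \<Longrightarrow> f (x + y) = f x + f y"
    and "x \<in> carr A \<Longrightarrow> f (smul A c x) = smul B c (f x)"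
    and "x \<in> carr A \<Longrightarrow> y \<in> carr A \<Longrightarrow> f (brk A x y) = brk B (f x) (f y)"
  using assms by (auto simp: alg_hom_def)

context fd_algebra
begin

lemmas carr_closed [simp] = subspace_0[OF carr_subspace] subspace_add[OF carr_subspace]
  subspace_diff[OF carr_subspace] subspace_scale[OF carr_subspace] brk_closed

lemma carr_sum: "(\<And>i. i \<in> I \<Longrightarrow> f i \<in> carr A) \<Longrightarrow> sum f I \<in> carr A"
  by (rule subspace_sum[OF carr_subspace])

lemma brk_zero [simp]:
  assumes "x \<in> carr A"
  shows "brk A x 0 = 0" "brk A 0 x = 0"
  using brk_add_left[of 0 0 x] brk_add_right[of x 0 0] assms by simp_all

lemma finite_if_independent:
  assumes "independent B" "B \<subseteq> carr A"
  shows "finite B"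
  using carr_fin_dim independent_span_bound assms by metis

lemma hom_zero:
  assumes "alg_hom A B f"
  shows "f 0 = 0"
  using alg_homD(2)[OF assms, of 0 0] by simp

lemma hom_diff:
  assumes "alg_hom A B f" "x \<in> carr A" "y \<in> carr A"
  shows "f (x - y) = f x - f y"
  using alg_homD(2)[OF assms(1), of "x - y" y] assms(2,3) by (simp add: algebra_simps)

lemma brk_sum:
  assumes "x \<in> carr A" "\<And>i. i \<in> I \<Longrightarrow> f i \<in> carr A"
  shows "brk A x (sum f I) = (\<Sum>i\<in>I. brk A x (f i))"
    and "brk A (sum f I) x = (\<Sum>i\<in>I. brk A (f i) x)"
  using assms
  by (induction I rule: infinite_finite_induct)
    (simp_all add: carr_sum brk_add_left brk_add_right)

lemma hom_sum:
  assumes "alg_hom A B f" "\<And>i. i \<in> I \<Longrightarrow> g i \<in> carr A"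
  shows "f (sum g I) = (\<Sum>i\<in>I. f (g i))"
  using assms(2)
proof (induction I rule: infinite_finite_induct)
  case (insert i I)
  then show ?case
    by (simp add: alg_homD(2)[OF assms(1)] carr_sum)
qed (simp_all add: hom_zero[OF assms(1)])

end

text \<open>First isomorphism theorem: \<open>A\<close> and \<open>B\<close> are both the quotient of \<open>U\<close> by the common kernel.\<close>

lemma alg_iso_if_same_kernel:
  assumes "fd_algebra U"
    and f: "alg_hom U A f" "f ` carr U = carr A"
    and g: "alg_hom U B g" "g ` carr U = carr B"
    and ker: "\<And>z. z \<in> carr U \<Longrightarrow> f z = 0 \<longleftrightarrow> g z = 0"
  shows "A \<simeq> B"
proof -
  interpret U: fd_algebra U by fact
  define h where "h = g \<circ> inv_into (carr U) f"
  have eq: "f z = f w \<longleftrightarrow> g z = g w" if "z \<in> carr U" "w \<in> carr U" for z w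
    using ker[of "z - w"] that U.hom_diff[OF f(1) that] U.hom_diff[OF g(1) that] by simp
  have h: "h (f z) = g z" if "z \<in> carr U" for z
    unfolding h_def comp_def
    using that eq[of "inv_into (carr U) f (f z)" z] by (simp add: inv_into_into f_inv_into_f)
  note fD = alg_homD(2-4)[OF f(1), symmetric]
  have "alg_hom A B h"
    unfolding alg_hom_def f(2)[symmetric]
    by (auto simp: h alg_homD(1)[OF g(1)] fD alg_homD(2,3,4)[OF g(1)])
  moreover have "bij_betw h (carr A) (carr B)"
    unfolding bij_betw_def inj_on_def f(2)[symmetric] g(2)[symmetric]
    by (auto simp: h eq image_image)
  ultimately show ?thesis
    unfolding alg_iso_def by blast
qed

text \<open>
  Only the image of the kernel term \<open>V\<close> in \<open>E\<close> matters. Its embedding is linear merely on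
  \<open>carr V\<close>, so the dimension is carried over through a basis of \<open>V\<close> and the linear map on the
  whole type that agrees with the embedding on this basis.
\<close>

lemma central_extension_iff:
  fixes E :: "'a::ab_group_add calg"
  shows "central_extension k E L \<longleftrightarrow> leibniz_algebra E \<and> leibniz_algebra L \<and>
     (\<exists>\<pi>. alg_hom E L \<pi> \<and> \<pi> ` carr E = carr L \<and>
        {x \<in> carr E. \<pi> x = 0} \<subseteq> alg_center E \<and>
        vector_space.dim (smul E) {x \<in> carr E. \<pi> x = 0} = k)"
    (is "_ \<longleftrightarrow> ?R")
proof
  assume "central_extension k E L"
  then obtain V :: "'a calg" and \<iota> \<pi> where
    EL: "leibniz_algebra E" "leibniz_algebra L" and V: "leibniz_algebra V" "alg_dim V = k" and
    \<iota>: "alg_hom V E \<iota>" "inj_on \<iota> (carr V)" and \<pi>: "alg_hom E L \<pi>" "\<pi> ` carr E = carr L" and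
    ker: "\<iota> ` carr V = {x \<in> carr E. \<pi> x = 0}" "\<iota> ` carr V \<subseteq> alg_center E"
    unfolding central_extension_def by (elim conjE exE) (rule that; assumption)
  interpret E: leibniz_algebra E by fact
  interpret V: leibniz_algebra V by fact
  interpret VE: vector_space_pair "smul V" "smul E" ..
  obtain B where B: "B \<subseteq> carr V" "V.independent B" "carr V \<subseteq> V.span B"
      "card B = V.dim (carr V)"
    using V.basis_exists[of "carr V"] by metis
  have spB: "V.span B = carr V"
    using B V.span_minimal[OF B(1) V.carr_subspace] by blast
  obtain g where g: "Vector_Spaces.linear (smul V) (smul E) g" "\<And>x. x \<in> B \<Longrightarrow> g x = \<iota> x"
    using VE.linear_independent_extend[OF B(2), of \<iota>] by blast
  interpret g: Vector_Spaces.linear "smul V" "smul E" g by fact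
  have "x \<in> carr V \<and> g x = \<iota> x" if "x \<in> V.span B" for x
    using that
  proof (induction rule: V.span_induct_alt)
    case base
    show ?case by (simp add: V.hom_zero[OF \<iota>(1)])
  next
    case (step c x y)
    then have "x \<in> carr V" using B(1) by blast
    with step show ?case
      by (simp add: g.add g.scale g(2) alg_homD(2,3)[OF \<iota>(1)])
  qed
  then have g\<iota>: "g x = \<iota> x" if "x \<in> carr V" for x
    using that spB by simp
  have img: "g ` carr V = \<iota> ` carr V" and inj: "inj_on g (V.span B)"
    using g\<iota> \<iota>(2) unfolding spB by (auto simp: inj_on_def)
  have "E.independent (g ` B)"
    by (rule g.independent_injective_image[OF B(2) inj])
  then have "E.dim (E.span (g ` B)) = card (g ` B)"
    by (rule E.dim_span_eq_card_independent)
  also have "card (g ` B) = card B"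
    using inj V.span_superset by (meson card_image inj_on_subset)
  also have "E.span (g ` B) = \<iota> ` carr V"
    by (simp add: g.span_image spB img)
  finally have "E.dim (\<iota> ` carr V) = k"
    using B(4) V(2) by (simp add: alg_dim_def)
  then show ?R
    using EL \<pi> ker by auto
next
  assume ?R
  then obtain \<pi> where EL: "leibniz_algebra E" "leibniz_algebra L"
    and \<pi>: "alg_hom E L \<pi>" "\<pi> ` carr E = carr L"
    and cen: "{x \<in> carr E. \<pi> x = 0} \<subseteq> alg_center E"
    and dim: "vector_space.dim (smul E) {x \<in> carr E. \<pi> x = 0} = k"
    by blast
  interpret E: leibniz_algebra E by fact
  interpret L: leibniz_algebra L by fact
  define K where "K = {x \<in> carr E. \<pi> x = 0}"
  define V where "V = \<lparr>carr = K, smul = smul E, brk = brk E\<rparr>"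
  have K: "K \<subseteq> carr E" by (auto simp: K_def)
  have sub: "E.subspace K"
    unfolding E.subspace_def K_def
    by (auto simp: E.hom_zero[OF \<pi>(1)] alg_homD(2,3)[OF \<pi>(1)])
  have brk0: "brk E x y = 0" if "x \<in> K" "y \<in> K" for x y
    using cen that unfolding K_def alg_center_def by blast
  have K0: "0 \<in> K" using sub E.subspace_0 by blast
  obtain B where B: "B \<subseteq> K" "E.independent B" "K \<subseteq> E.span B"
    using E.basis_exists[of K] by metis
  have "finite B" "E.span B = K"
    using E.finite_if_independent B K E.span_minimal[OF B(1) sub] by auto
  then have "leibniz_algebra V"
    unfolding leibniz_algebra_def fd_algebra_def fd_algebra_axioms_def leibniz_algebra_axioms_def
      V_def
    using sub K0 by (auto simp: brk0 E.vector_space_axioms E.subspace_add E.subspace_scale)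
  moreover have "alg_dim V = k"
    using dim by (simp add: alg_dim_def V_def K_def)
  moreover have "alg_hom V E id"
    using K by (auto simp: alg_hom_def V_def)
  ultimately show "central_extension k E L"
    unfolding central_extension_def using EL \<pi> cen
    by (intro conjI exI[of _ V] exI[of _ id] exI[of _ \<pi>]) (auto simp: V_def K_def)
qed

text \<open>
  If \<open>S\<close> were proper, it would miss some central \<open>v\<close> with \<open>\<pi> v = 0\<close>, because \<open>S\<close> already maps onto
  \<open>L\<close>. A hyperplane \<open>H\<close> that contains \<open>S\<close> but not \<open>v\<close> contains all products, so it is a subalgebra
  and again a central extension of \<open>L\<close>, with kernel one dimension smaller; the line through \<open>v\<close>
  then splits off. Thus a non-split extension is generated by any lifts of generators of \<open>L\<close>.
\<close>

lemma nonsplit_extension_generated: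
  assumes ns: "nonsplit_extension k E L"
    and \<pi>: "alg_hom E L \<pi>" "{x \<in> carr E. \<pi> x = 0} \<subseteq> alg_center E"
      "vector_space.dim (smul E) {x \<in> carr E. \<pi> x = 0} = k"
    and S: "module.subspace (smul E) S" "S \<subseteq> carr E" "\<pi> ` S = carr L"
    and brkS: "\<And>x y. x \<in> carr E \<Longrightarrow> y \<in> carr E \<Longrightarrow> brk E x y \<in> S"
  shows "S = carr E"
proof (rule ccontr)
  assume "S \<noteq> carr E"
  have ce: "central_extension k E L"
    using ns by (simp add: nonsplit_extension_def)
  then have "leibniz_algebra E" "leibniz_algebra L"
    by (simp_all add: central_extension_def)
  interpret E: leibniz_algebra E by fact
  interpret L: leibniz_algebra L by fact
  define K where "K = {x \<in> carr E. \<pi> x = 0}"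
  have K: "E.subspace K" "K \<subseteq> carr E"
    unfolding E.subspace_def K_def
    by (auto simp: E.hom_zero[OF \<pi>(1)] alg_homD(2,3)[OF \<pi>(1)])
  obtain u where u: "u \<in> carr E" "u \<notin> S"
    using \<open>S \<noteq> carr E\<close> S(2) by blast
  obtain s where s: "s \<in> S" "\<pi> s = \<pi> u"
    using S(3) alg_homD(1)[OF \<pi>(1) u(1)] by (metis imageE)
  define v where "v = u - s"
  have "v \<in> K"
    using u s S(2) by (auto simp: v_def K_def E.hom_diff[OF \<pi>(1)])
  have "v \<notin> S"
    using u(2) s(1) E.subspace_add[OF S(1), of v s] by (auto simp: v_def)
  have v: "v \<in> carr E" using \<open>v \<in> K\<close> K by blast
  obtain B0 where B0: "B0 \<subseteq> S" "E.independent B0" "S \<subseteq> E.span B0"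
    using E.basis_exists[of S] by metis
  have sp0: "E.span B0 = S"
    using B0 E.span_minimal[OF B0(1) S(1)] by blast
  have "E.independent (insert v B0)"
    using E.independent_insertI[of v B0] B0 \<open>v \<notin> S\<close> sp0 by simp
  then obtain B where B: "insert v B0 \<subseteq> B" "B \<subseteq> carr E" "E.independent B" "carr E \<subseteq> E.span B"
    using E.maximal_independent_subset_extend[of "insert v B0" "carr E"] B0 S(2) v by blast
  have spB: "E.span B = carr E"
    using B(4) E.span_minimal[OF B(2) E.carr_subspace] by blast
  define H where "H = E.span (B - {v})"
  have H: "E.subspace H" "H \<subseteq> carr E"
    using E.span_mono[of "B - {v}" B] spB by (auto simp: H_def)
  have "v \<notin> B0" using \<open>v \<notin> S\<close> B0 by blast
  then have SH: "S \<subseteq> H"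
    using E.span_mono[of B0 "B - {v}"] B(1) sp0 unfolding H_def by blast
  have vH: "v \<notin> H"
    using B(1,3) by (auto simp: H_def E.dependent_def)
  have decomp: "\<exists>c. x - smul E c v \<in> H" if "x \<in> carr E" for x
    using that E.span_breakdown_eq[of x v "B - {v}"] spB B(1)
    by (auto simp: H_def insert_absorb)
  have uniq: "c = 0" if "smul E c v \<in> H" for c
    using E.subspace_scale[OF H(1) that, of "inverse c"] vH by (cases "c = 0") auto
  have vcen: "brk E x v = 0" "brk E v x = 0" if "x \<in> carr E" for x
    using \<open>v \<in> K\<close> \<pi>(2) that unfolding K_def[symmetric] alg_center_def by auto
  define L' where "L' = \<lparr>carr = H, smul = smul E, brk = brk E\<rparr>"
  have L'_sel [simp]: "carr L' = H" "smul L' = smul E" "brk L' = brk E"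
    by (simp_all add: L'_def)
  have finB: "finite (B - {v})"
    using E.finite_if_independent[OF B(3,2)] by simp
  have HE: "x \<in> carr E" if "x \<in> H" for x using H(2) that by blast
  have "leibniz_algebra L'"
    unfolding leibniz_algebra_def fd_algebra_def fd_algebra_axioms_def leibniz_algebra_axioms_def
    using H(1) finB brkS SH HE
    by (auto simp: E.vector_space_axioms E.brk_add_left E.brk_add_right E.brk_smul_left
        E.brk_smul_right E.leibniz H_def[symmetric] intro!: exI[of _ "B - {v}"])
  moreover have "alg_hom L' L \<pi>"
    using \<pi>(1) HE by (auto simp: alg_hom_def)
  moreover have "\<pi> ` carr L' = carr L"
    using S(3) SH HE alg_homD(1)[OF \<pi>(1)] by (simp add: image_subset_iff) blast
  moreover have "{x \<in> carr L'. \<pi> x = 0} \<subseteq> alg_center L'"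
    using \<pi>(2) HE by (auto simp: alg_center_def)
  ultimately have ce': "central_extension (E.dim {x \<in> H. \<pi> x = 0}) L' L"
    unfolding central_extension_iff using \<open>leibniz_algebra L\<close> by (auto intro!: exI[of _ \<pi>])
  have "k = Suc (E.dim {x \<in> H. \<pi> x = 0})"
  proof -
    have eq: "{x \<in> H. \<pi> x = 0} = H \<inter> K" using HE by (auto simp: K_def)
    obtain C where C: "C \<subseteq> H \<inter> K" "E.independent C" "H \<inter> K \<subseteq> E.span C" "card C = E.dim (H \<inter> K)"
      using E.basis_exists[of "H \<inter> K"] by metis
    have spC: "E.span C = H \<inter> K"
      using C(3) E.span_minimal[OF C(1) E.subspace_inter[OF H(1) K(1)]] by blast
    have ind: "E.independent (insert v C)"
      using E.independent_insertI[OF _ C(2), of v] spC vH by simp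
    have "E.span (insert v C) = K"
    proof
      show "E.span (insert v C) \<subseteq> K"
        using C(1) \<open>v \<in> K\<close> by (intro E.span_minimal K) auto
      show "K \<subseteq> E.span (insert v C)"
      proof
        fix x assume "x \<in> K"
        then obtain c where "x - smul E c v \<in> H" using decomp K by blast
        moreover have "x - smul E c v \<in> K"
          using \<open>x \<in> K\<close> \<open>v \<in> K\<close> K(1) by (simp add: E.subspace_diff E.subspace_scale)
        ultimately show "x \<in> E.span (insert v C)"
          unfolding E.span_breakdown_eq spC by blast
      qed
    qed
    then have "E.dim K = card (insert v C)"
      using E.dim_span_eq_card_independent[OF ind] by simp
    moreover have "v \<notin> C" "finite C"
      using vH C(1) E.finite_if_independent[OF C(2)] K by auto
    ultimately show ?thesis
      using C(4) \<pi>(3) unfolding eq K_def[symmetric] by simp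
  qed
  moreover have "E \<simeq> direct_sum L' abelian_line"
  proof -
    define g where "g = (\<lambda>(h, c). h + smul E c v)"
    define D where "D = direct_sum L' abelian_line"
    have D: "carr D = H \<times> UNIV" "smul D c (x, a) = (smul E c x, c * a)"
      "brk D (x, a) (y, b) = (brk E x y, 0)" for c x y a b
      by (simp_all add: D_def direct_sum_def abelian_line_def)
    have inj: "inj_on g (carr D)"
    proof (rule inj_onI)
      fix z w assume zw: "z \<in> carr D" "w \<in> carr D" "g z = g w"
      obtain x a y b where [simp]: "z = (x, a)" "w = (y, b)" by fastforce
      have xy: "x - y = smul E (b - a) v"
        using zw(3) by (simp add: g_def E.scale_left_diff_distrib algebra_simps)
      moreover have "x - y \<in> H"
        using zw D E.subspace_diff[OF H(1)] by simp
      ultimately have "b - a = 0" using uniq[of "b - a"] by metis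
      with xy show "z = w" by simp
    qed
    have surj: "g ` carr D = carr E"
    proof
      show "g ` carr D \<subseteq> carr E"
        using HE v by (auto simp: g_def D)
      show "carr E \<subseteq> g ` carr D"
      proof
        fix x assume "x \<in> carr E"
        then obtain c where "x - smul E c v \<in> H" using decomp by blast
        then show "x \<in> g ` carr D"
          by (intro image_eqI[of _ _ "(x - smul E c v, c)"]) (auto simp: g_def D)
      qed
    qed
    have gadd: "g (z + w) = g z + g w" for z w
      by (auto simp: g_def E.scale_left_distrib algebra_simps split: prod.splits)
    have gsmul: "g (smul D c z) = smul E c (g z)" for c z
      by (cases z) (simp add: g_def D E.scale_right_distrib)
    have gbrk: "g (brk D z w) = brk E (g z) (g w)" if "z \<in> carr D" "w \<in> carr D" for z w
      using that HE v
      by (cases z, cases w)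
        (simp add: g_def D E.brk_add_left E.brk_add_right E.brk_smul_left E.brk_smul_right vcen)
    define f where "f = inv_into (carr D) g"
    have fg: "f (g z) = z" if "z \<in> carr D" for z
      using inj that by (simp add: f_def)
    have Dcl: "z + w \<in> carr D" "smul D c z \<in> carr D" "brk D z w \<in> carr D"
      if "z \<in> carr D" "w \<in> carr D" for z w c
      using that H(1) SH brkS HE
      by (cases z, cases w, auto simp: D E.subspace_add E.subspace_scale)+
    have "alg_hom E D f"
      unfolding alg_hom_def surj[symmetric]
      by (auto simp: fg gadd[symmetric] gsmul[symmetric] gbrk[symmetric] Dcl)
    moreover have "bij_betw f (carr E) (carr D)"
      unfolding f_def using inj surj by (intro bij_betw_inv_into) (simp add: bij_betw_def)
    ultimately show ?thesis
      unfolding alg_iso_def D_def by blast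
  qed
  ultimately have "split_extension k E L"
    using ce ce' unfolding split_extension_def by blast
  then show False
    using ns by (simp add: nonsplit_extension_def)
qed

section \<open>The universal central extension\<close>

lemma table_algebra_sel [simp]:
  "carr (table_algebra N T) = {x. \<forall>k. k \<notin> {1..N} \<longrightarrow> x k = 0}"
  "smul (table_algebra N T) = scl"
  by (simp_all add: table_algebra_def)

lemma sum_fun_eval: "(\<Sum>i\<in>I. f i) k = (\<Sum>i\<in>I. f i k)"
  for f :: "'i \<Rightarrow> nat \<Rightarrow> complex"
  by (induction I rule: infinite_finite_induct) auto

text \<open>
  All multiplication tables in question have products only with \<open>e 1\<close> and one further generator
  \<open>e l\<close> on the right. The coordinate \<open>k\<close> of a product receives the left factor's coordinate \<open>src\<close>
  through multiplication by \<open>e 1\<close> (when \<open>R\<close> holds), and \<open>b\<close>, \<open>c\<close>, \<open>d\<close> are the \<open>k\<close>-coordinates of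
  \<open>[e l, e 1]\<close>, \<open>[e 1, e l]\<close>, \<open>[e l, e l]\<close>.
\<close>

lemma brk_table_algebra:
  assumes T: "\<And>i j. T i j k =
      (if j = 1 then (if R \<and> i = src then 1 else 0) + (if i = l then b else 0) else 0) +
      (if j = l then (if i = 1 then c else 0) + (if i = l then d else 0) else 0)"
    and l: "2 \<le> l" "l \<le> N" and src: "R \<Longrightarrow> 1 \<le> src \<and> src \<le> N"
  shows "brk (table_algebra N T) x y k =
      y 1 * ((if R then x src else 0) + x l * b) + y l * (x 1 * c + x l * d)"
proof -
  have "brk (table_algebra N T) x y k = (\<Sum>i=1..N. \<Sum>j=1..N. x i * y j * T i j k)"
    by (simp add: table_algebra_def sum_fun_eval scl_def)
  also have "\<dots> = (\<Sum>i=1..N. \<Sum>j=1..N.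
      (if j = 1 then x i * y 1 * ((if R \<and> i = src then 1 else 0) + (if i = l then b else 0)) else 0) +
      (if j = l then x i * y l * ((if i = 1 then c else 0) + (if i = l then d else 0)) else 0))"
    unfolding T using l by (intro sum.cong refl) auto
  also have "\<dots> = (\<Sum>i=1..N. 
      x i * y 1 * ((if R \<and> i = src then 1 else 0) + (if i = l then b else 0)) +
      x i * y l * ((if i = 1 then c else 0) + (if i = l then d else 0)))"
    using l by (intro sum.cong refl) (simp add: sum.distrib)
  also have "\<dots> = (\<Sum>i=1..N. 
      (if i = src then (if R then x src * y 1 else 0) else 0) + (if i = l then x l * y 1 * b else 0) +
      (if i = 1 then x 1 * y l * c else 0) + (if i = l then x l * y l * d else 0))"
    by (intro sum.cong refl) (auto simp: algebra_simps)
  also have "\<dots> = (if R then x src * y 1 else 0) + x l * y 1 * b + x 1 * y l * c + x l * y l * d"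
    using l src by (simp add: sum.distrib) 
  finally show ?thesis
    by (simp add: algebra_simps)
qed

text \<open>
  With \<open>x = e 1\<close> and \<open>y = e (n + 1)\<close>, the elements \<open>e 1, \<dots>, e (n - 1)\<close> are the left powers of \<open>x\<close>.
  The last power \<open>e n\<close> and the products \<open>[y, x] = e (n + 2)\<close>, \<open>[x, y] = e (n + 3)\<close> and
  \<open>[y, y] = e (n + 4)\<close> span a copy of the dual of the four-dimensional second cohomology space of the algebra
  \<open>F2_algebra n\<close>, which is the quotient by this central subspace. In the quotient \<open>y\<close> becomes the
  generator called \<open>e 2\<close> there.
\<close>

definition universal_extension :: "nat \<Rightarrow> (nat \<Rightarrow> complex) calg" where
  "universal_extension n = table_algebra (n + 4) (\<lambda>i j.
     if 1 \<le> i \<and> i \<le> n - 1 \<and> j = 1 then e (i + 1)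
     else if i = n + 1 \<and> j = 1 then e (n + 2)
     else if i = 1 \<and> j = n + 1 then e (n + 3)
     else if i = n + 1 \<and> j = n + 1 then e (n + 4)
     else 0)"

lemma universal_extension_sel [simp]:
  "carr (universal_extension n) = {x. \<forall>k. k \<notin> {1..n + 4} \<longrightarrow> x k = 0}"
  "smul (universal_extension n) = scl"
  by (simp_all add: universal_extension_def)

lemma brk_universal_extension:
  assumes "n \<ge> 3"
  shows "brk (universal_extension n) x y k =
     (if 2 \<le> k \<and> k \<le> n then x (k - 1) * y 1
      else if k = n + 2 then x (n + 1) * y 1
      else if k = n + 3 then x 1 * y (n + 1)
      else if k = n + 4 then x (n + 1) * y (n + 1)
      else 0)"
  unfolding universal_extension_def using assms
  by (subst brk_table_algebra[where l = "n + 1" and R = "2 \<le> k \<and> k \<le> n" and src = "k - 1"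
        and b = "if k = n + 2 then 1 else 0" and c = "if k = n + 3 then 1 else 0"
        and d = "if k = n + 4 then 1 else 0"]) (auto simp: e_def)

lemma brk_Q_algebra:
  assumes "n \<ge> 3"
  shows "brk (Q_algebra n (\<alpha>4, \<beta>3, \<beta>4, \<gamma>3, \<gamma>4)) x y k =
     (if 2 \<le> k \<and> k < n then x (k - 1) * y 1
      else if k = n then x (n - 1) * y 1 + \<alpha>4 * x (n + 1) * y (n + 1)
      else if k = n + 2 then x (n + 1) * y 1 + \<beta>3 * x 1 * y (n + 1) + \<beta>4 * x (n + 1) * y (n + 1)
      else if k = n + 3 then \<gamma>3 * x 1 * y (n + 1) + \<gamma>4 * x (n + 1) * y (n + 1)
      else 0)"
  unfolding Q_algebra_def prod.case
proof (rule trans[OF brk_table_algebra[where l = "n + 1" and R = "2 \<le> k \<and> k \<le> n"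
        and src = "k - 1" and b = "if k = n + 2 then 1 else 0"
        and c = "if k = n + 2 then \<beta>3 else if k = n + 3 then \<gamma>3 else 0"
        and d = "if k = n then \<alpha>4 else if k = n + 2 then \<beta>4 else if k = n + 3 then \<gamma>4 else 0"]],
      goal_cases)
  case (1 i j)
  consider "j = 1" | "j = n + 1" "i = 1" | "j = n + 1" "i = n + 1" | "j = n + 1" "i \<noteq> 1" "i \<noteq> n + 1"
    | "j \<noteq> 1" "j \<noteq> n + 1" by blast
  then show ?case
    using assms by cases (auto simp: e_def scl_def)
next
  case 5
  consider "k < n" | "k = n" | "k = n + 1" | "k = n + 2" | "k = n + 3" | "k > n + 3" by linarith
  then show ?case
    using assms by cases (simp_all add: algebra_simps)
qed (use assms in auto)

lemma brk_Q_star: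
  assumes "n \<ge> 3"
  shows "brk (Q_star n) x y k =
     (if 2 \<le> k \<and> k < n then x (k - 1) * y 1
      else if k = n + 1 then x n * y 1
      else if k = n + 2 then x 1 * y n
      else if k = n + 3 then x n * y n
      else 0)"
  unfolding Q_star_def using assms
  by (subst brk_table_algebra[where l = n and R = "2 \<le> k \<and> k < n" and src = "k - 1"
        and b = "if k = n + 1 then 1 else 0" and c = "if k = n + 2 then 1 else 0"
        and d = "if k = n + 3 then 1 else 0"]) (auto simp: e_def)

lemma brk_F2_algebra:
  assumes "n \<ge> 3"
  shows "brk (F2_algebra n) x y k =
     (if k = 3 then x 1 * y 1 else if 4 \<le> k \<and> k \<le> n then x (k - 1) * y 1 else 0)"
  unfolding F2_algebra_def using assms
  by (subst brk_table_algebra[where l = 2 and R = "3 \<le> k \<and> k \<le> n"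
        and src = "if k = 3 then 1 else k - 1" and b = 0 and c = 0 and d = 0]) (auto simp: e_def)

lemma F2_algebra_sel [simp]:
  "carr (F2_algebra n) = {x. \<forall>k. k \<notin> {1..n} \<longrightarrow> x k = 0}"
  "smul (F2_algebra n) = scl"
  by (simp_all add: F2_algebra_def)

lemma Q_algebra_sel [simp]:
  "carr (Q_algebra n p) = {x. \<forall>k. k \<notin> {1..n + 3} \<longrightarrow> x k = 0}"
  "smul (Q_algebra n p) = scl"
  by (cases p; simp add: Q_algebra_def)+

lemma Q_star_sel [simp]:
  "carr (Q_star n) = {x. \<forall>k. k \<notin> {1..n + 3} \<longrightarrow> x k = 0}"
  "smul (Q_star n) = scl"
  by (simp_all add: Q_star_def)

lemma fd_algebra_universal_extension:
  assumes "n \<ge> 3"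
  shows "fd_algebra (universal_extension n)"
proof -
  interpret vector_space scl
    by unfold_locales (auto simp: scl_def fun_eq_iff algebra_simps)
  have mem: "e k \<in> carr (universal_extension n)" if "k \<in> {1..n + 4}" for k
    using that by (auto simp: e_def)
  have sub: "subspace (carr (universal_extension n))"
    by (auto simp: subspace_def scl_def)
  have "span (e ` {1..n + 4}) = carr (universal_extension n)"
  proof
    show "span (e ` {1..n + 4}) \<subseteq> carr (universal_extension n)"
      using mem by (intro span_minimal sub) blast
    show "carr (universal_extension n) \<subseteq> span (e ` {1..n + 4})"
    proof
      fix x assume x: "x \<in> carr (universal_extension n)"
      have "x = (\<Sum>i\<in>{1..n + 4}. x i \<cdot> e i)"
        using x by (auto simp: fun_eq_iff sum_fun_eval scl_def e_def if_distrib cong: if_cong)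
      also have "\<dots> \<in> span (e ` {1..n + 4})"
        by (intro span_sum span_scale span_base) simp
      finally show "x \<in> span (e ` {1..n + 4})" .
    qed
  qed
  then show ?thesis
    using sub
    by unfold_locales
      (auto intro!: exI[of _ "e ` {1..n + 4}"] simp: fun_eq_iff brk_universal_extension[OF assms]
        scl_def algebra_simps)
qed

definition relation_vector :: "nat \<Rightarrow> complex \<times> complex \<times> complex \<times> complex \<Rightarrow> nat \<Rightarrow> complex" where
  "relation_vector n = (\<lambda>(p, q, r, s) k.
     if k = n then p else if k = n + 2 then q else if k = n + 3 then r
     else if k = n + 4 then s else 0)"

text \<open>
  \<open>presented_by n A (p, q, r, s)\<close>: the algebra \<open>A\<close> arises from the universal extension by imposing
  the single linear relation \<open>p x\<^sup>n + q [y, x] + r [x, y] + s [y, y] = 0\<close> between the central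
  generators, where \<open>x\<^sup>n\<close> is the left power \<open>e n\<close>.
\<close>

definition presented_by ::
    "nat \<Rightarrow> 'a::ab_group_add calg \<Rightarrow> complex \<times> complex \<times> complex \<times> complex \<Rightarrow> bool" where
  "presented_by n A \<rho> \<longleftrightarrow>
     (\<exists>\<Phi>. alg_hom (universal_extension n) A \<Phi> \<and> \<Phi> ` carr (universal_extension n) = carr A \<and>
        (\<forall>z\<in>carr (universal_extension n). \<Phi> z = 0 \<longleftrightarrow> (\<exists>t. z = t \<cdot> relation_vector n \<rho>)))"

lemma presented_by_unique:
  assumes "n \<ge> 3" "presented_by n A \<rho>" "presented_by n B \<rho>"
  shows "A \<simeq> B"
proof -
  obtain \<Phi> where \<Phi>: "alg_hom (universal_extension n) A \<Phi>"
      "\<Phi> ` carr (universal_extension n) = carr A"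
      "\<forall>z\<in>carr (universal_extension n). \<Phi> z = 0 \<longleftrightarrow> (\<exists>t. z = t \<cdot> relation_vector n \<rho>)"
    using assms(2) unfolding presented_by_def by metis
  obtain \<Psi> where \<Psi>: "alg_hom (universal_extension n) B \<Psi>"
      "\<Psi> ` carr (universal_extension n) = carr B"
      "\<forall>z\<in>carr (universal_extension n). \<Psi> z = 0 \<longleftrightarrow> (\<exists>t. z = t \<cdot> relation_vector n \<rho>)"
    using assms(3) unfolding presented_by_def by metis
  show ?thesis
    using alg_iso_if_same_kernel[OF fd_algebra_universal_extension[OF assms(1)] \<Phi>(1,2) \<Psi>(1,2)]
      \<Phi>(3) \<Psi>(3) by metis
qed

lemma presented_by_iso:
  assumes n: "n \<ge> 3" and pres: "presented_by n A \<rho>" and "A \<simeq> B"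
  shows "presented_by n B \<rho>"
proof -
  interpret U: fd_algebra "universal_extension n"
    by (rule fd_algebra_universal_extension[OF n])
  obtain \<Phi> where \<Phi>: "alg_hom (universal_extension n) A \<Phi>"
      "\<Phi> ` carr (universal_extension n) = carr A"
      "\<forall>z\<in>carr (universal_extension n). \<Phi> z = 0 \<longleftrightarrow> (\<exists>t. z = t \<cdot> relation_vector n \<rho>)"
    using pres unfolding presented_by_def by metis
  obtain f where f: "alg_hom A B f" "bij_betw f (carr A) (carr B)"
    using \<open>A \<simeq> B\<close> unfolding alg_iso_def by blast
  note \<Phi>D = alg_homD[OF \<Phi>(1)]
  have hom: "alg_hom (universal_extension n) B (f \<circ> \<Phi>)"
    unfolding alg_hom_def
    by (auto simp del: universal_extension_sel simp add: \<Phi>D alg_homD[OF f(1)])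
  have z0: "0 \<in> carr (universal_extension n)" by simp
  have "f (\<Phi> z) = 0 \<longleftrightarrow> \<Phi> z = 0" if z: "z \<in> carr (universal_extension n)" for z
  proof -
    have "f (\<Phi> 0) = 0" using U.hom_zero[OF hom] by simp
    then have "f (\<Phi> z) = 0 \<longleftrightarrow> f (\<Phi> z) = f (\<Phi> 0)" by simp
    also have "\<dots> \<longleftrightarrow> \<Phi> z = \<Phi> 0"
      using inj_onD[OF bij_betw_imp_inj_on[OF f(2)]] \<Phi>D(1)[OF z] \<Phi>D(1)[OF z0] by metis
    finally show ?thesis using U.hom_zero[OF \<Phi>(1)] by simp
  qed
  moreover have "(f \<circ> \<Phi>) ` carr (universal_extension n) = carr B"
    using \<Phi>(2) f(2) by (metis bij_betw_imp_surj_on image_comp)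
  ultimately show ?thesis
    unfolding presented_by_def using hom \<Phi>(3) by (intro exI[of _ "f \<circ> \<Phi>"]) simp
qed

text \<open>
  The relation satisfied in the \<open>Q\<close>-algebra: its table expresses \<open>[x, y]\<close> and \<open>[y, y]\<close> through
  \<open>x\<^sup>n\<close>, \<open>[y, x]\<close> and the vector \<open>e (n + 3)\<close>, and eliminating \<open>e (n + 3)\<close> leaves
  \<open>\<gamma>4 [x, y] - \<gamma>3 [y, y] = (\<beta>3 \<gamma>4 - \<beta>4 \<gamma>3) [y, x] - \<alpha>4 \<gamma>3 x\<^sup>n\<close>.
\<close>

definition Q_relation :: "Q_param \<Rightarrow> complex \<times> complex \<times> complex \<times> complex" where
  "Q_relation = (\<lambda>(\<alpha>4, \<beta>3, \<beta>4, \<gamma>3, \<gamma>4). (\<alpha>4 * \<gamma>3, \<beta>4 * \<gamma>3 - \<beta>3 * \<gamma>4, \<gamma>4, - \<gamma>3))"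

text \<open>
  If \<open>\<gamma>3 = \<gamma>4 = 0\<close>, no product would reach \<open>e (n + 3)\<close>, and \<open>x\<close>, \<open>y\<close> would not generate the algebra.
\<close>

lemma presented_by_Q_algebra:
  assumes n: "n \<ge> 3" and nz: "\<gamma>3 \<noteq> 0 \<or> \<gamma>4 \<noteq> 0"
  shows "presented_by n (Q_algebra n (\<alpha>4, \<beta>3, \<beta>4, \<gamma>3, \<gamma>4)) (Q_relation (\<alpha>4, \<beta>3, \<beta>4, \<gamma>3, \<gamma>4))"
    (is "presented_by n ?Q ?\<rho>")
proof -
  define \<Phi> :: "(nat \<Rightarrow> complex) \<Rightarrow> nat \<Rightarrow> complex" where "\<Phi> z = (\<lambda>k.
    if k = n then z n + \<alpha>4 * z (n + 4)
    else if k = n + 2 then z (n + 2) + \<beta>3 * z (n + 3) + \<beta>4 * z (n + 4)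
    else if k = n + 3 then \<gamma>3 * z (n + 3) + \<gamma>4 * z (n + 4)
    else if k = n + 4 then 0 else z k)" for z
  have "\<Phi> (x + y) = \<Phi> x + \<Phi> y" "\<Phi> (c \<cdot> x) = c \<cdot> \<Phi> x" for x y c
    by (simp_all add: fun_eq_iff \<Phi>_def scl_def algebra_simps)
  moreover have keep: "\<Phi> z j = z j" if "j \<notin> {n, n + 2, n + 3, n + 4}" for z j
    using that by (simp add: \<Phi>_def)
  moreover have "\<Phi> (brk (universal_extension n) x y) = brk ?Q (\<Phi> x) (\<Phi> y)" for x y
  proof
    fix k
    have low: "\<Phi> z 1 = z 1" "\<Phi> z (n - 1) = z (n - 1)" "\<Phi> z (n + 1) = z (n + 1)"
      "k < n \<Longrightarrow> \<Phi> z (k - 1) = z (k - 1)" for z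
      using n by (auto intro!: keep)
    show "\<Phi> (brk (universal_extension n) x y) k = brk ?Q (\<Phi> x) (\<Phi> y) k"
      unfolding brk_Q_algebra[OF n] low
      using n by (auto simp: low(4)[simplified] \<Phi>_def[of "brk (universal_extension n) x y"]
          brk_universal_extension[OF n])
  qed
  moreover have closed: "\<Phi> x \<in> carr ?Q" if x: "x \<in> carr (universal_extension n)" for x
    unfolding Q_algebra_sel mem_Collect_eq
  proof (intro allI impI)
    fix k assume "k \<notin> {1..n + 3}"
    then show "\<Phi> x k = 0"
      using x n keep[of k x] by (cases "k = n + 4") (auto simp: \<Phi>_def[of x])
  qed
  ultimately have "alg_hom (universal_extension n) ?Q \<Phi>"
    unfolding alg_hom_def by auto
  moreover have "\<Phi> ` carr (universal_extension n) = carr ?Q"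
  proof
    show "\<Phi> ` carr (universal_extension n) \<subseteq> carr ?Q"
      using closed by blast
    show "carr ?Q \<subseteq> \<Phi> ` carr (universal_extension n)"
    proof
      fix w assume w: "w \<in> carr ?Q"
      define C where "C = (if \<gamma>3 = 0 then 0 else w (n + 3) / \<gamma>3)"
      define D where "D = (if \<gamma>3 = 0 then w (n + 3) / \<gamma>4 else 0)"
      define z where "z = (\<lambda>k. if k = n then w n - \<alpha>4 * D
        else if k = n + 2 then w (n + 2) - \<beta>3 * C - \<beta>4 * D
        else if k = n + 3 then C else if k = n + 4 then D else w k)"
      have "\<gamma>3 * C + \<gamma>4 * D = w (n + 3)"
        using nz by (cases "\<gamma>3 = 0") (simp_all add: C_def D_def)
      moreover have "w (n + 4) = 0"
        using w by simp
      ultimately have "w k = \<Phi> z k" for k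
        by (simp add: \<Phi>_def z_def)
      then have "w = \<Phi> z" by blast
      moreover have "z \<in> carr (universal_extension n)"
        unfolding universal_extension_sel mem_Collect_eq
      proof (intro allI impI)
        fix k assume "k \<notin> {1..n + 4}"
        then have "k \<notin> {n, n + 2, n + 3, n + 4}" "k \<notin> {1..n + 3}"
          using n by auto
        then show "z k = 0" using w by (simp add: z_def)
      qed
      ultimately show "w \<in> \<Phi> ` carr (universal_extension n)" by blast
    qed
  qed
  moreover have "\<Phi> z = 0 \<longleftrightarrow> (\<exists>t. z = t \<cdot> relation_vector n ?\<rho>)"
    if z: "z \<in> carr (universal_extension n)" for z
  proof
    assume 0: "\<Phi> z = 0"
    have "\<Phi> z n = 0" "\<Phi> z (n + 2) = 0" "\<Phi> z (n + 3) = 0"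
      using 0 by simp_all
    then have c: "z n = - (\<alpha>4 * z (n + 4))"
      "z (n + 2) = - (\<beta>3 * z (n + 3) + \<beta>4 * z (n + 4))"
      "\<gamma>3 * z (n + 3) = - (\<gamma>4 * z (n + 4))"
      unfolding eq_neg_iff_add_eq_0 by (simp_all add: \<Phi>_def add.assoc)
    have rest: "z k = 0" if "k \<notin> {n, n + 2, n + 3, n + 4}" for k
      using fun_cong[OF 0, of k] that by (simp add: \<Phi>_def)
    define t where "t = (if \<gamma>3 = 0 then z (n + 3) / \<gamma>4 else - z (n + 4) / \<gamma>3)"
    have CD: "z (n + 3) = t * \<gamma>4 \<and> z (n + 4) = - (t * \<gamma>3)"
    proof (cases "\<gamma>3 = 0")
      case True
      then show ?thesis using nz c(3) by (simp add: t_def)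
    next
      case False
      then have "z (n + 3) = - \<gamma>4 * z (n + 4) / \<gamma>3"
        using c(3) by (metis minus_mult_left nonzero_mult_div_cancel_left)
      with False show ?thesis by (simp add: t_def)
    qed
    have "z k = (t \<cdot> relation_vector n ?\<rho>) k" for k
    proof (cases "k \<in> {n, n + 2, n + 3, n + 4}")
      case True
      then consider "k = n" | "k = n + 2" | "k = n + 3" | "k = n + 4" by blast
      then show ?thesis
        by cases (simp_all add: scl_def relation_vector_def Q_relation_def c(1)
            c(2)[simplified] CD algebra_simps)
    next
      case False
      then show ?thesis
        by (simp add: rest scl_def relation_vector_def Q_relation_def)
    qed
    then show "\<exists>t. z = t \<cdot> relation_vector n ?\<rho>" by blast
  next
    assume "\<exists>t. z = t \<cdot> relation_vector n ?\<rho>"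
    then obtain t where t: "z = t \<cdot> relation_vector n ?\<rho>" by blast
    show "\<Phi> z = 0"
    proof
      fix k
      show "\<Phi> z k = 0 k"
        unfolding t \<Phi>_def by (simp add: scl_def relation_vector_def Q_relation_def algebra_simps)
    qed
  qed
  ultimately show ?thesis
    unfolding presented_by_def by (intro exI[of _ \<Phi>] conjI ballI)
qed

text \<open>
  The table of \<open>Q_star\<close> is that of the universal extension with \<open>e n\<close> dropped and the later
  basis vectors renumbered.
\<close>

lemma presented_by_Q_star:
  assumes n: "n \<ge> 3"
  shows "presented_by n (Q_star n) (1, 0, 0, 0)"
proof -
  define \<Phi> :: "(nat \<Rightarrow> complex) \<Rightarrow> nat \<Rightarrow> complex" where
    "\<Phi> z = (\<lambda>k. if k < n then z k else z (Suc k))" for z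
  have "\<Phi> (x + y) = \<Phi> x + \<Phi> y" "\<Phi> (c \<cdot> x) = c \<cdot> \<Phi> x" for x y c
    by (simp_all add: fun_eq_iff \<Phi>_def scl_def)
  moreover have "\<Phi> (brk (universal_extension n) x y) = brk (Q_star n) (\<Phi> x) (\<Phi> y)" for x y
  proof
    fix k
    have low: "\<Phi> z 1 = z 1" "\<Phi> z n = z (n + 1)" "k < n \<Longrightarrow> \<Phi> z (k - 1) = z (k - 1)" for z
      using n by (auto simp: \<Phi>_def)
    show "\<Phi> (brk (universal_extension n) x y) k = brk (Q_star n) (\<Phi> x) (\<Phi> y) k"
      unfolding brk_Q_star[OF n] low
      using n by (auto simp: low(3)[simplified] \<Phi>_def[of "brk (universal_extension n) x y"]
          brk_universal_extension[OF n])
  qed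
  moreover have "\<Phi> x \<in> carr (Q_star n)" if "x \<in> carr (universal_extension n)" for x
    using that n by (auto simp: \<Phi>_def)
  ultimately have "alg_hom (universal_extension n) (Q_star n) \<Phi>"
    unfolding alg_hom_def by auto
  moreover have "\<Phi> ` carr (universal_extension n) = carr (Q_star n)"
  proof
    show "\<Phi> ` carr (universal_extension n) \<subseteq> carr (Q_star n)"
      using n by (auto simp: \<Phi>_def)
    show "carr (Q_star n) \<subseteq> \<Phi> ` carr (universal_extension n)"
    proof
      fix w assume w: "w \<in> carr (Q_star n)"
      define z where "z = (\<lambda>k. if k < n then w k else if k = n then 0 else w (k - 1))"
      have "w = \<Phi> z"
        by (auto simp: fun_eq_iff \<Phi>_def z_def)
      moreover have "z \<in> carr (universal_extension n)"
        unfolding universal_extension_sel mem_Collect_eq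
      proof (intro allI impI)
        fix k assume "k \<notin> {1..n + 4}"
        then have "k = 0 \<or> k - 1 \<notin> {1..n + 3}" by auto
        then show "z k = 0" using w n \<open>k \<notin> {1..n + 4}\<close> by (auto simp: z_def)
      qed
      ultimately show "w \<in> \<Phi> ` carr (universal_extension n)" by blast
    qed
  qed
  moreover have "\<Phi> z = 0 \<longleftrightarrow> (\<exists>t. z = t \<cdot> relation_vector n (1, 0, 0, 0))" for z
  proof
    assume 0: "\<Phi> z = 0"
    have "z k = 0" if "k \<noteq> n" for k
    proof (cases "k < n")
      case True
      then show ?thesis using fun_cong[OF 0, of k] by (simp add: \<Phi>_def)
    next
      case False
      then show ?thesis using fun_cong[OF 0, of "k - 1"] that by (simp add: \<Phi>_def split: if_splits)
    qed
    then have "z = z n \<cdot> relation_vector n (1, 0, 0, 0)"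
      by (auto simp: fun_eq_iff scl_def relation_vector_def)
    then show "\<exists>t. z = t \<cdot> relation_vector n (1, 0, 0, 0)" by blast
  next
    assume "\<exists>t. z = t \<cdot> relation_vector n (1, 0, 0, 0)"
    then show "\<Phi> z = 0"
      by (auto simp: fun_eq_iff \<Phi>_def scl_def relation_vector_def)
  qed
  ultimately show ?thesis
    unfolding presented_by_def by (intro exI[of _ \<Phi>] conjI ballI)
qed

section \<open>Change of generators\<close>

text \<open>
  The substitution \<open>x \<mapsto> a x + b y\<close>, \<open>y \<mapsto> c y + d e (n - 1)\<close> defines an endomorphism of the universal
  extension with
  \<open>x\<^sup>n \<mapsto> a\<^sup>n x\<^sup>n\<close>, \<open>[y, x] \<mapsto> a c [y, x] + b c [y, y] + a d x\<^sup>n\<close>,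
  \<open>[x, y] \<mapsto> a c [x, y] + b c [y, y]\<close> and \<open>[y, y] \<mapsto> c\<^sup>2 [y, y]\<close>.
  The function \<open>transform\<close> is its action on the coefficients of a relation.
\<close>

definition transform ::
    "nat \<Rightarrow> complex \<Rightarrow> complex \<Rightarrow> complex \<Rightarrow> complex \<Rightarrow>
      complex \<times> complex \<times> complex \<times> complex \<Rightarrow> complex \<times> complex \<times> complex \<times> complex" where
  "transform n a b c d = (\<lambda>(p, q, r, s).
     (p * a ^ n + q * a * d, q * a * c, r * a * c, (q + r) * b * c + s * c\<^sup>2))"

text \<open>
  For \<open>a, c \<noteq> 0\<close> the substitution is an automorphism \<open>\<psi>\<close>. Composing a presentation of \<open>A\<close>
  with \<open>\<psi>\<close> replaces the kernel by its preimage under \<open>\<psi>\<close>, and \<open>\<psi>\<close> maps the line of \<open>\<sigma>\<close> to that of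
  \<open>(p, q, r, s)\<close>.
\<close>

lemma presented_by_transform:
  assumes n: "n \<ge> 3" and pres: "presented_by n A (p, q, r, s)"
    and nz: "a \<noteq> 0" "c \<noteq> 0" "t \<noteq> 0"
    and tr: "transform n a b c d \<sigma> = (t * p, t * q, t * r, t * s)"
  shows "presented_by n A \<sigma>"
proof -
  let ?U = "universal_extension n"
  obtain \<Phi> where \<Phi>: "alg_hom ?U A \<Phi>" "\<Phi> ` carr ?U = carr A"
      "\<And>z. z \<in> carr ?U \<Longrightarrow> \<Phi> z = 0 \<longleftrightarrow> (\<exists>u. z = u \<cdot> relation_vector n (p, q, r, s))"
    using pres unfolding presented_by_def by metis
  \<comment> \<open>The terms with \<open>z 2\<close> come from
    \<open>[a x + b y, a x + b y] = a\<^sup>2 e 2 + a b ([x, y] + [y, x]) + b\<^sup>2 [y, y]\<close>.\<close>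
  define \<psi> where "\<psi> z = (\<lambda>k.
    if k = n - 1 then a ^ k * z k + d * z (n + 1)
    else if k = n then a ^ n * z n + a * d * z (n + 2)
    else if k = n + 1 then b * z 1 + c * z (n + 1)
    else if k = n + 2 then a * c * z (n + 2) + a * b * z 2
    else if k = n + 3 then a * c * z (n + 3) + a * b * z 2
    else if k = n + 4 then c\<^sup>2 * z (n + 4) + b * c * (z (n + 2) + z (n + 3)) + b\<^sup>2 * z 2
    else a ^ k * z k)" for z :: "nat \<Rightarrow> complex"
  have \<psi>_at: "\<psi> z (n - 1) = a ^ (n - 1) * z (n - 1) + d * z (n + 1)"
    "\<psi> z n = a ^ n * z n + a * d * z (n + 2)"
    "\<psi> z (n + 1) = b * z 1 + c * z (n + 1)"
    "\<psi> z (n + 2) = a * c * z (n + 2) + a * b * z 2"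
    "\<psi> z (n + 3) = a * c * z (n + 3) + a * b * z 2"
    "\<psi> z (n + 4) = c\<^sup>2 * z (n + 4) + b * c * (z (n + 2) + z (n + 3)) + b\<^sup>2 * z 2" for z
    using n by (auto simp: \<psi>_def)
  have \<psi>_other: "\<psi> z k = a ^ k * z k" if "k \<notin> {n - 1, n, n + 1, n + 2, n + 3, n + 4}" for z k
    using that by (simp add: \<psi>_def)
  have \<psi>_1: "\<psi> z 1 = a * z 1" for z
    using n by (subst \<psi>_other) auto
  have add: "\<psi> (x + y) = \<psi> x + \<psi> y" and scale: "\<psi> (u \<cdot> x) = u \<cdot> \<psi> x" for x y u
    by (auto simp: fun_eq_iff \<psi>_def scl_def algebra_simps)
  have closed: "\<psi> z \<in> carr ?U" if z: "z \<in> carr ?U" for z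
    unfolding universal_extension_sel mem_Collect_eq
  proof (intro allI impI)
    fix k assume k: "k \<notin> {1..n + 4}"
    then have "k \<notin> {n - 1, n, n + 1, n + 2, n + 3, n + 4}" using n by auto
    then show "\<psi> z k = 0" using z k by (simp add: \<psi>_other)
  qed
  have brk: "\<psi> (brk ?U z w) = brk ?U (\<psi> z) (\<psi> w)" for z w
  proof
    fix k
    consider "k < 2" | "2 \<le> k" "k < n - 1" | "k = n - 1" | "k = n" | "k = n + 1" | "k = n + 2"
      | "k = n + 3" | "k = n + 4" | "n + 4 < k" by linarith
    then show "\<psi> (brk ?U z w) k = brk ?U (\<psi> z) (\<psi> w) k"
    proof cases
      case 1
      then show ?thesis
        using n by (subst \<psi>_other) (auto simp: brk_universal_extension)
    next
      case 2
      then have "a ^ k = a ^ (k - 1) * a"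
        by (metis One_nat_def Suc_diff_1 less_le_trans pos2 power_Suc2)
      moreover have "k - 1 \<notin> {n - 1, n, n + 1, n + 2, n + 3, n + 4}"
        "k \<notin> {n - 1, n, n + 1, n + 2, n + 3, n + 4}" using 2 by auto
      ultimately show ?thesis
        using n 2 by (simp add: \<psi>_other \<psi>_1[simplified] brk_universal_extension algebra_simps)
    next
      case 3
      have "k = Suc (k - 1)"
        using 3 n by simp
      then have "a ^ k = a ^ (k - 1) * a"
        by (metis power_Suc2)
      moreover have "k - 1 \<notin> {n - 1, n, n + 1, n + 2, n + 3, n + 4}" using 3 n by auto
      then have "\<psi> z (k - 1) = a ^ (k - 1) * z (k - 1)" by (rule \<psi>_other)
      moreover have "2 \<le> k" "k \<le> n" using 3 n by auto
      ultimately show ?thesis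
        using n unfolding 3 \<psi>_at by (simp add: \<psi>_1[simplified] brk_universal_extension)
    next
      case 4
      have "a ^ n = a ^ (n - 1) * a"
        using n by (cases n) auto
      then show ?thesis
        using n unfolding 4 \<psi>_at
        by (simp add: \<psi>_1[simplified] \<psi>_at(1)[simplified] brk_universal_extension algebra_simps)
    next
      case 5
      then show ?thesis
        using n unfolding 5 \<psi>_at by (simp add: brk_universal_extension)
    next
      case 6
      then show ?thesis
        using n unfolding 6 \<psi>_at
        by (simp add: \<psi>_1[simplified] \<psi>_at[simplified] brk_universal_extension algebra_simps)
    next
      case 7
      then show ?thesis
        using n unfolding 7 \<psi>_at
        by (simp add: \<psi>_1[simplified] \<psi>_at[simplified] brk_universal_extension algebra_simps)
    next
      case 8
      then show ?thesis
        using n unfolding 8 \<psi>_at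
        by (simp add: \<psi>_1[simplified] \<psi>_at[simplified] brk_universal_extension algebra_simps
            power2_eq_square)
    next
      case 9
      then show ?thesis
        using n by (subst \<psi>_other) (auto simp: brk_universal_extension)
    qed
  qed
  have inj: "z = 0" if "\<psi> z = 0" for z
  proof -
    have 0: "\<psi> z k = 0" for k using that by simp
    have z1: "z 1 = 0" using 0[of 1] nz by (simp add: \<psi>_1[simplified])
    have y: "z (n + 1) = 0" using 0[of "n + 1"] nz z1 unfolding \<psi>_at by simp
    have low: "z k = 0" if "k < n" for k
    proof (cases "k = n - 1")
      case True
      then show ?thesis using 0[of "n - 1"] nz y unfolding \<psi>_at by simp
    next
      case False
      then show ?thesis using 0[of k] nz that by (simp add: \<psi>_other)
    qed
    have z2: "z 2 = 0" using low n by simp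
    have B: "z (n + 2) = 0" using 0[of "n + 2"] nz z2 unfolding \<psi>_at by simp
    have C: "z (n + 3) = 0" using 0[of "n + 3"] nz z2 unfolding \<psi>_at by simp
    have D: "z (n + 4) = 0" using 0[of "n + 4"] nz z2 B C unfolding \<psi>_at by simp
    have A: "z n = 0" using 0[of n] nz B unfolding \<psi>_at by simp
    have "z k = 0" if "k > n + 4" for k
      using 0[of k] nz that by (simp add: \<psi>_other)
    moreover have "k < n \<or> k \<in> {n, n + 1, n + 2, n + 3, n + 4} \<or> k > n + 4" for k
      by auto
    ultimately have "z k = 0" for k
      using low y A B C D by (metis insertE singletonD)
    then show ?thesis by (simp add: fun_eq_iff)
  qed
  have surj: "\<exists>z\<in>carr ?U. \<psi> z = w" if w: "w \<in> carr ?U" for w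
  proof -
    \<comment> \<open>Solve the equations in the order \<open>x\<close>, \<open>y\<close>, powers of \<open>x\<close> below \<open>n\<close>, then the central part.\<close>
    define y where "y = (w (n + 1) - b * (w 1 / a)) / c"
    define z2 where "z2 = (if n = 3 then (w 2 - d * y) / a\<^sup>2 else w 2 / a\<^sup>2)"
    define B where "B = (w (n + 2) - a * b * z2) / (a * c)"
    define C where "C = (w (n + 3) - a * b * z2) / (a * c)"
    define z where "z = (\<lambda>k.
      if k = n - 1 then (w k - d * y) / a ^ k
      else if k = n then (w n - a * d * B) / a ^ n
      else if k = n + 1 then y
      else if k = n + 2 then B
      else if k = n + 3 then C
      else if k = n + 4 then (w (n + 4) - b * c * (B + C) - b\<^sup>2 * z2) / c\<^sup>2
      else w k / a ^ k)"
    have z_other: "z k = w k / a ^ k" if "k \<notin> {n - 1, n, n + 1, n + 2, n + 3, n + 4}" for k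
      using that by (simp add: z_def)
    have z_at: "z 2 = z2" "z 1 = w 1 / a" "z (n - 1) = (w (n - 1) - d * y) / a ^ (n - 1)"
      "z n = (w n - a * d * B) / a ^ n" "z (n + 1) = y" "z (n + 2) = B" "z (n + 3) = C"
      "z (n + 4) = (w (n + 4) - b * c * (B + C) - b\<^sup>2 * z2) / c\<^sup>2"
      using n by (auto simp: z_def z2_def)
    have "z \<in> carr ?U"
      unfolding universal_extension_sel mem_Collect_eq
    proof (intro allI impI)
      fix k assume k: "k \<notin> {1..n + 4}"
      then have "k \<notin> {n - 1, n, n + 1, n + 2, n + 3, n + 4}" using n by auto
      then show "z k = 0" using w k by (simp add: z_other)
    qed
    moreover have "\<psi> z = w"
    proof
      fix k
      consider "k = n - 1" | "k = n" | "k = n + 1" | "k = n + 2" | "k = n + 3" | "k = n + 4"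
        | "k \<notin> {n - 1, n, n + 1, n + 2, n + 3, n + 4}" by blast
      then show "\<psi> z k = w k"
      proof cases
        case 1 then show ?thesis unfolding 1 \<psi>_at z_at using nz by simp
      next
        case 2 then show ?thesis unfolding 2 \<psi>_at z_at using nz by simp
      next
        case 3 then show ?thesis unfolding 3 \<psi>_at z_at using nz by (simp add: y_def)
      next
        case 4 then show ?thesis unfolding 4 \<psi>_at z_at using nz by (simp add: B_def)
      next
        case 5 then show ?thesis unfolding 5 \<psi>_at z_at using nz by (simp add: C_def)
      next
        case 6 then show ?thesis unfolding 6 \<psi>_at z_at using nz by simp
      next
        case 7 then show ?thesis using nz by (simp add: \<psi>_other z_other)
      qed
    qed
    ultimately show ?thesis by blast
  qed
  have rel: "\<psi> (relation_vector n \<sigma>) = t \<cdot> relation_vector n (p, q, r, s)"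
  proof
    fix k
    obtain p' q' r' s' where \<sigma>: "\<sigma> = (p', q', r', s')" by (cases \<sigma>)
    have tr': "p' * a ^ n + q' * a * d = t * p" "q' * a * c = t * q" "r' * a * c = t * r"
      "(q' + r') * b * c + s' * c\<^sup>2 = t * s"
      using tr by (simp_all add: transform_def \<sigma>)
    have rv: "relation_vector n \<sigma> k = (if k = n then p' else if k = n + 2 then q'
      else if k = n + 3 then r' else if k = n + 4 then s' else 0)" for k
      by (simp add: relation_vector_def \<sigma>)
    consider "k = n - 1" | "k = n" | "k = n + 1" | "k = n + 2" | "k = n + 3" | "k = n + 4"
      | "k \<notin> {n - 1, n, n + 1, n + 2, n + 3, n + 4}" by blast
    then show "\<psi> (relation_vector n \<sigma>) k = (t \<cdot> relation_vector n (p, q, r, s)) k"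
    proof cases
      case 1 then show ?thesis
        unfolding 1 \<psi>_at rv using n by (auto simp: scl_def relation_vector_def)
    next
      case 2 then show ?thesis
        unfolding 2 \<psi>_at rv using n tr'(1) by (auto simp: scl_def relation_vector_def algebra_simps)
    next
      case 3 then show ?thesis
        unfolding 3 \<psi>_at rv using n by (auto simp: scl_def relation_vector_def)
    next
      case 4 then show ?thesis
        unfolding 4 \<psi>_at rv using n tr'(2) by (auto simp: scl_def relation_vector_def algebra_simps)
    next
      case 5 then show ?thesis
        unfolding 5 \<psi>_at rv using n tr'(3) by (auto simp: scl_def relation_vector_def algebra_simps)
    next
      case 6 then show ?thesis
        unfolding 6 \<psi>_at rv using n tr'(4) by (auto simp: scl_def relation_vector_def algebra_simps)
    next
      case 7 then show ?thesis
        by (simp add: \<psi>_other scl_def relation_vector_def \<sigma>)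
    qed
  qed
  have hom: "alg_hom ?U A (\<Phi> \<circ> \<psi>)"
    unfolding alg_hom_def
    by (auto simp del: universal_extension_sel(1)
        simp add: add scale brk closed alg_homD[OF \<Phi>(1)] alg_homD(3)[OF \<Phi>(1), simplified])
  have "(\<Phi> \<circ> \<psi>) ` carr ?U = \<Phi> ` (\<psi> ` carr ?U)"
    by (rule image_comp[symmetric])
  also have "\<psi> ` carr ?U = carr ?U"
    using closed surj by blast
  finally have img: "(\<Phi> \<circ> \<psi>) ` carr ?U = carr A"
    using \<Phi>(2) by simp
  have ker: "(\<Phi> \<circ> \<psi>) z = 0 \<longleftrightarrow> (\<exists>u. z = u \<cdot> relation_vector n \<sigma>)" if z: "z \<in> carr ?U" for z
  proof
    assume "(\<Phi> \<circ> \<psi>) z = 0"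
    then obtain u where u: "\<psi> z = u \<cdot> relation_vector n (p, q, r, s)"
      using \<Phi>(3)[OF closed[OF z]] by auto
    have "\<psi> (z + (- (u / t)) \<cdot> relation_vector n \<sigma>) = 0"
      unfolding add scale rel u using nz by (simp add: scl_def fun_eq_iff)
    then have "z + (- (u / t)) \<cdot> relation_vector n \<sigma> = 0" by (rule inj)
    then have "z = (u / t) \<cdot> relation_vector n \<sigma>"
      by (simp add: scl_def fun_eq_iff add_eq_0_iff2)
    then show "\<exists>u. z = u \<cdot> relation_vector n \<sigma>" by blast
  next
    assume "\<exists>u. z = u \<cdot> relation_vector n \<sigma>"
    then obtain u where "z = u \<cdot> relation_vector n \<sigma>" by blast
    then have "\<psi> z = (u * t) \<cdot> relation_vector n (p, q, r, s)"
      by (simp only: scale rel) (simp add: scl_def mult.assoc)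
    then show "(\<Phi> \<circ> \<psi>) z = 0"
      using \<Phi>(3)[OF closed[OF z]] by auto
  qed
  show ?thesis
    unfolding presented_by_def using hom img ker by metis
qed

text \<open>
  A substitution with \<open>a = 1\<close> brings every relation that involves a product with \<open>y\<close> to one of the
  tabulated ones. If \<open>q \<noteq> 0\<close>, the parameter \<open>d\<close> absorbs \<open>p\<close>, the ratio \<open>r / q\<close> cannot be changed, and
  \<open>b\<close> adjusts \<open>s\<close> unless \<open>q + r = 0\<close>; in that exceptional case \<open>s\<close> can only be rescaled. If \<open>q = 0\<close>,
  then \<open>p\<close> cannot be absorbed but only rescaled; \<open>b\<close> adjusts \<open>s\<close> when \<open>r \<noteq> 0\<close>.
\<close>

lemma transform_normal_form:
  assumes "(q, r, s) \<noteq> (0, 0, 0)"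
  shows "\<exists>\<rho>\<in>Q_params. \<exists>b c d t. c \<noteq> 0 \<and> t \<noteq> 0 \<and>
    transform n 1 b c d (Q_relation \<rho>) = (t * p, t * q, t * r, t * s)"
proof -
  have witness: ?thesis if "\<rho> \<in> Q_params" "c \<noteq> 0" "t \<noteq> 0"
    "transform n 1 b c d (Q_relation \<rho>) = (t * p, t * q, t * r, t * s)" for \<rho> b c d t
    using that by blast
  consider "q \<noteq> 0" "q + r \<noteq> 0" | "q \<noteq> 0" "r = - q" "s = 0" | "q \<noteq> 0" "r = - q" "s \<noteq> 0"
    | "q = 0" "r \<noteq> 0" "p = 0" | "q = 0" "r \<noteq> 0" "p \<noteq> 0"
    | "q = 0" "r = 0" "s \<noteq> 0" "p = 0" | "q = 0" "r = 0" "s \<noteq> 0" "p \<noteq> 0"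
    using assms by (auto simp: add_eq_0_iff)
  then show ?thesis
  proof cases
    case 1
    have "1 + r / q \<noteq> 0"
      using 1 by (metis add_divide_distrib divide_self divide_eq_0_iff)
    then show ?thesis
      using 1 by (intro witness[of "(0, 0, 1, 1, r / q)" 1 "1 / q" "(s / q + 1) / (1 + r / q)" "p / q"])
        (simp_all add: Q_params_def transform_def Q_relation_def)
  next
    case 2
    then show ?thesis
      by (intro witness[of "(0, 1, 0, 0, 1)" 1 "- 1 / q" 0 "p / q"])
        (simp_all add: Q_params_def transform_def Q_relation_def)
  next
    case 3
    then show ?thesis
      by (intro witness[of "(0, 0, 1, 1, - 1)" "- s / q" "- s / q\<^sup>2" 0 "- s * p / q\<^sup>2"])
        (simp_all add: Q_params_def transform_def Q_relation_def field_simps power2_eq_square)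
  next
    case 4
    then show ?thesis
      by (intro witness[of "(0, 0, 0, 1, 1)" 1 "1 / r" "s / r + 1" 0])
        (simp_all add: Q_params_def transform_def Q_relation_def)
  next
    case 5
    then show ?thesis
      by (intro witness[of "(1, 0, 0, 1, 1)" "r / p" "1 / p" "s / r + r / p" 0])
        (simp_all add: Q_params_def transform_def Q_relation_def field_simps power2_eq_square)
  next
    case 6
    then show ?thesis
      by (intro witness[of "(0, 0, 0, 1, 0)" 1 "- 1 / s" 0 0])
        (simp_all add: Q_params_def transform_def Q_relation_def)
  next
    case 7
    then show ?thesis
      by (intro witness[of "(1, 0, 0, 1, 0)" "csqrt (- s / p)" "1 / p" 0 0])
        (simp_all add: Q_params_def transform_def Q_relation_def)
  qed
qed

text \<open>
  The vanishing of \<open>q\<close>, of \<open>r\<close>, of \<open>p\<close> when \<open>q = 0\<close> and of \<open>s\<close> when \<open>q + r = 0\<close> is preserved by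
  \<open>transform\<close> with \<open>a, c \<noteq> 0\<close>, as is the ratio \<open>r / q\<close>; together these data separate the parameters.
\<close>

lemma transform_Q_relation_unique:
  assumes "\<rho> \<in> Q_params" "\<sigma> \<in> Q_params" "a \<noteq> 0" "c \<noteq> 0" "Q_relation \<sigma> = (p, q, r, s)"
    and "transform n a b c d (Q_relation \<rho>) = (t * p, t * q, t * r, t * s)"
  shows "\<rho> = \<sigma>"
proof -
  have "\<gamma> = - 1" if "a * c = - (\<gamma> * a * c)" for \<gamma>
  proof -
    have "(1 + \<gamma>) * (a * c) = 0"
      using that by (simp only: distrib_right mult_1_left mult.assoc eq_neg_iff_add_eq_0)
    then show ?thesis
      using assms(3,4) by (simp add: add_eq_0_iff)
  qed
  then show ?thesis
    using assms unfolding Q_params_def by (auto simp: Q_relation_def transform_def)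
qed

section \<open>The relation is determined up to a change of generators\<close>

primrec left_power :: "'a calg \<Rightarrow> 'a \<Rightarrow> nat \<Rightarrow> 'a" where
  "left_power A x 0 = x"
| "left_power A x (Suc k) = brk A (left_power A x k) x"

text \<open>
  Right multiplication by \<open>x\<close> shifts the coordinates up to \<open>n\<close> by one. The terms with \<open>e (n + 1)\<close> become
  central after one step and vanish after two, hence \<open>k \<ge> 2\<close>.
\<close>

lemma left_power_universal_extension:
  assumes n: "n \<ge> 3" and "k \<ge> 2"
  shows "left_power (universal_extension n) x k j =
    (if k + 1 \<le> j \<and> j \<le> n then x (j - k) * x 1 ^ k else 0)"
  using assms(2)
proof (induction k arbitrary: j rule: nat_induct_at_least)
  case base
  show ?case
    using n by (auto simp: numeral_2_eq_2 brk_universal_extension)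
next
  case (Suc k)
  then show ?case
    using n by (auto simp: brk_universal_extension)
qed

lemma left_power_hom:
  assumes "fd_algebra A" "alg_hom A B f" "x \<in> carr A"
  shows "left_power A x k \<in> carr A \<and> f (left_power A x k) = left_power B (f x) k"
proof -
  interpret fd_algebra A by fact
  show ?thesis
    by (induction k) (simp_all add: assms(3) alg_homD(4)[OF assms(2)])
qed

lemma left_power_top:
  assumes "n \<ge> 3"
  shows "left_power (universal_extension n) x (n - 1) = x 1 ^ n \<cdot> e n"
proof
  fix j
  have "x 1 * x 1 ^ (n - 1) = x 1 ^ n"
    using assms by (metis One_nat_def Suc_diff_1 less_le_trans power_Suc zero_less_numeral)
  then show "left_power (universal_extension n) x (n - 1) j = (x 1 ^ n \<cdot> e n) j"
    using assms left_power_universal_extension[of n "n - 1" x j] by (auto simp: scl_def e_def)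
qed

text \<open>
  The first presentation makes all left powers \<open>z\<^sup>n\<close> in \<open>A\<close> vanish, since \<open>z\<^sup>n\<close> in the universal
  extension is a multiple of \<open>e n\<close> for every \<open>z\<close>. So \<open>e n\<close> lies in the kernel of the second as well.
\<close>

lemma presented_by_top_power_relation:
  assumes n: "n \<ge> 3" and "presented_by n A (1, 0, 0, 0)" "presented_by n A (p, q, r, s)"
  shows "(q, r, s) = (0, 0, 0)"
proof -
  let ?U = "universal_extension n"
  have U: "fd_algebra ?U" by (rule fd_algebra_universal_extension[OF n])
  obtain \<Phi> where \<Phi>: "alg_hom ?U A \<Phi>" "\<Phi> ` carr ?U = carr A"
      "\<And>z. z \<in> carr ?U \<Longrightarrow> \<Phi> z = 0 \<longleftrightarrow> (\<exists>u. z = u \<cdot> relation_vector n (1, 0, 0, 0))"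
    using assms(2) unfolding presented_by_def by metis
  obtain \<Psi> where \<Psi>: "alg_hom ?U A \<Psi>" "\<Psi> ` carr ?U = carr A"
      "\<And>z. z \<in> carr ?U \<Longrightarrow> \<Psi> z = 0 \<longleftrightarrow> (\<exists>u. z = u \<cdot> relation_vector n (p, q, r, s))"
    using assms(3) unfolding presented_by_def by metis
  have e: "e 1 \<in> carr ?U" "e n \<in> carr ?U"
    using n by (auto simp: e_def)
  obtain X where X: "X \<in> carr ?U" "\<Phi> X = \<Psi> (e 1)"
    using alg_homD(1)[OF \<Psi>(1) e(1)] \<Phi>(2) by (metis imageE)
  have "\<Psi> (e n) = \<Psi> (left_power ?U (e 1) (n - 1))"
    unfolding left_power_top[OF n] by (simp add: e_def scl_def)
  also have "\<dots> = \<Phi> (left_power ?U X (n - 1))"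
    using left_power_hom[OF U \<Psi>(1) e(1)] left_power_hom[OF U \<Phi>(1) X(1)] X(2) by simp
  also have "\<dots> = 0"
  proof -
    have "left_power ?U X (n - 1) = X 1 ^ n \<cdot> relation_vector n (1, 0, 0, 0)"
      unfolding left_power_top[OF n] by (auto simp: fun_eq_iff scl_def e_def relation_vector_def)
    then show ?thesis
      using \<Phi>(3) left_power_hom[OF U \<Phi>(1) X(1)] by blast
  qed
  finally obtain u where u: "e n = u \<cdot> relation_vector n (p, q, r, s)"
    using \<Psi>(3) e(2) by blast
  have "e n k = u * relation_vector n (p, q, r, s) k" for k
    using u by (simp add: scl_def)
  from this[of n] this[of "n + 2"] this[of "n + 3"] this[of "n + 4"] show ?thesis
    by (auto simp: e_def relation_vector_def)
qed

text \<open>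
  Lift the images of \<open>x\<close> and \<open>y\<close> under the first presentation \<open>\<Phi>\<close> through the second one \<open>\<Psi>\<close> to
  elements \<open>X\<close> and \<open>Y\<close> of the universal extension. The kernel of \<open>\<Psi>\<close> contains no nonzero vector whose
  coordinates at \<open>[y, x]\<close>, \<open>[x, y]\<close> and \<open>[y, y]\<close> vanish. As \<open>[[y, y], y] = 0\<close> and \<open>[[y, x], x] = 0\<close>, the
  products \<open>[[Y, Y], Y]\<close> and \<open>[[Y, X], X]\<close> lie in this kernel and hence are zero, which leaves in \<open>Y\<close>
  only the terms of \<open>c y + d e (n - 1)\<close> and central ones. So \<open>X\<close> and \<open>Y\<close> transform relations as the
  substitution does; terms of \<open>X\<close> beyond \<open>a x + b y\<close> have no influence on the central products.
\<close>

lemma presented_by_transform_exists: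
  assumes n: "n \<ge> 3" and pres: "presented_by n A (p, q, r, s)" "presented_by n A (p', q', r', s')"
    and nz: "(q, r, s) \<noteq> (0, 0, 0)" "(q', r', s') \<noteq> (0, 0, 0)"
  shows "\<exists>a b c d t. a \<noteq> 0 \<and> c \<noteq> 0 \<and>
    transform n a b c d (p, q, r, s) = (t * p', t * q', t * r', t * s')"
proof -
  let ?U = "universal_extension n"
  have U: "fd_algebra ?U" by (rule fd_algebra_universal_extension[OF n])
  interpret U: fd_algebra ?U by (rule U)
  note U.carr_closed [simp del]
  note bU = brk_universal_extension[OF n]
  obtain \<Phi> where \<Phi>: "alg_hom ?U A \<Phi>" "\<Phi> ` carr ?U = carr A"
      "\<And>z. z \<in> carr ?U \<Longrightarrow> \<Phi> z = 0 \<longleftrightarrow> (\<exists>u. z = u \<cdot> relation_vector n (p, q, r, s))"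
    using pres(1) unfolding presented_by_def by metis
  obtain \<Psi> where \<Psi>: "alg_hom ?U A \<Psi>" "\<Psi> ` carr ?U = carr A"
      "\<And>z. z \<in> carr ?U \<Longrightarrow> \<Psi> z = 0 \<longleftrightarrow> (\<exists>u. z = u \<cdot> relation_vector n (p', q', r', s'))"
    using pres(2) unfolding presented_by_def by metis
  have e: "e 1 \<in> carr ?U" "e (n + 1) \<in> carr ?U"
    using n by (auto simp: e_def)
  obtain X where X: "X \<in> carr ?U" "\<Psi> X = \<Phi> (e 1)"
    using alg_homD(1)[OF \<Phi>(1) e(1)] \<Psi>(2) by (metis imageE)
  obtain Y where Y: "Y \<in> carr ?U" "\<Psi> Y = \<Phi> (e (n + 1))"
    using alg_homD(1)[OF \<Phi>(1) e(2)] \<Psi>(2) by (metis imageE)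
  have lift: "\<Psi> (brk ?U z w) = \<Phi> (brk ?U z' w') \<and> brk ?U z w \<in> carr ?U \<and> brk ?U z' w' \<in> carr ?U"
    if "\<Psi> z = \<Phi> z'" "\<Psi> w = \<Phi> w'" "z \<in> carr ?U" "w \<in> carr ?U" "z' \<in> carr ?U" "w' \<in> carr ?U"
    for z w z' w'
    using that by (simp del: universal_extension_sel
        add: alg_homD(4)[OF \<Phi>(1)] alg_homD(4)[OF \<Psi>(1)] U.brk_closed)
  have zero: "z = 0"
    if z: "z \<in> carr ?U" "\<Psi> z = 0" "z (n + 2) = 0" "z (n + 3) = 0" "z (n + 4) = 0" for z
  proof -
    obtain u where u: "z = u \<cdot> relation_vector n (p', q', r', s')"
      using z(1,2) \<Psi>(3) by blast
    have "u * q' = 0" "u * r' = 0" "u * s' = 0"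
      using z(3-5) unfolding u by (simp_all add: scl_def relation_vector_def)
    then have "u = 0" using nz(2) by auto
    then show ?thesis by (simp add: u scl_def fun_eq_iff)
  qed
  define a b c d where "a = X 1" and "b = X (n + 1)" and "c = Y (n + 1)" and "d = Y (n - 1)"
  have top: "\<Psi> (left_power ?U X (n - 1)) = \<Phi> (e n)" 
  proof -
    have "\<Psi> (left_power ?U X (n - 1)) = \<Phi> (left_power ?U (e 1) (n - 1))"
      using left_power_hom[OF U \<Phi>(1) e(1)] left_power_hom[OF U \<Psi>(1) X(1)] X(2) by simp
    also have "left_power ?U (e 1) (n - 1) = e n"
      unfolding left_power_top[OF n] by (simp add: e_def scl_def)
    finally show ?thesis .
  qed
  have not_zero: "\<Phi> (e n) \<noteq> 0"
  proof
    assume "\<Phi> (e n) = 0"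
    moreover have "e n \<in> carr ?U" using n by (auto simp: e_def)
    ultimately obtain u where "e n = u \<cdot> relation_vector n (p, q, r, s)"
      using \<Phi>(3) by blast
    then have "e n k = u * relation_vector n (p, q, r, s) k" for k
      by (simp add: scl_def)
    from this[of n] this[of "n + 2"] this[of "n + 3"] this[of "n + 4"] show False
      using nz(1) by (auto simp: e_def relation_vector_def)
  qed
  have "a \<noteq> 0"
  proof
    assume "a = 0"
    then have "left_power ?U X (n - 1) = 0"
      using n unfolding left_power_top[OF n] by (simp add: a_def scl_def fun_eq_iff)
    then show False using top not_zero U.hom_zero[OF \<Psi>(1)] by simp
  qed
  have Y1: "Y 1 = 0"
  proof -
    note YY = lift[OF Y(2,2) Y(1,1) e(2,2)]
    have "brk ?U (brk ?U (e (n + 1)) (e (n + 1))) (e (n + 1)) = 0"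
      using n by (auto simp: fun_eq_iff bU e_def)
    then have "\<Psi> (brk ?U (brk ?U Y Y) Y) = 0"
      using lift[OF _ Y(2) _ Y(1) _ e(2)] YY U.hom_zero[OF \<Phi>(1)] by metis
    moreover have "brk ?U (brk ?U Y Y) Y \<in> carr ?U"
      using Y(1) by (intro U.brk_closed)
    ultimately have "brk ?U (brk ?U Y Y) Y = 0"
      using n by (intro zero) (auto simp: bU)
    then have "brk ?U (brk ?U Y Y) Y 3 = 0" by simp
    then show ?thesis using n by (simp add: bU)
  qed
  have Ylow: "Y k = 0" if "1 \<le> k" "k \<le> n - 2" for k
  proof -
    note YX = lift[OF Y(2) X(2) Y(1) X(1) e(2,1)]
    have "brk ?U (brk ?U (e (n + 1)) (e 1)) (e 1) = 0"
      using n by (auto simp: fun_eq_iff bU e_def)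
    then have "\<Psi> (brk ?U (brk ?U Y X) X) = 0"
      using lift[OF _ X(2) _ X(1) _ e(1)] YX U.hom_zero[OF \<Phi>(1)] by metis
    moreover have "brk ?U (brk ?U Y X) X \<in> carr ?U"
      using X(1) Y(1) by (intro U.brk_closed)
    ultimately have "brk ?U (brk ?U Y X) X = 0"
      using n by (intro zero) (auto simp: bU)
    then have "brk ?U (brk ?U Y X) X (k + 2) = 0" by simp
    moreover have "k + 2 \<le> n"
      using n that by simp
    ultimately show ?thesis using that \<open>a \<noteq> 0\<close> by (simp add: bU a_def)
  qed
  have YX: "\<Psi> (brk ?U Y X) = \<Phi> (e (n + 2))" "brk ?U Y X \<in> carr ?U"
    and XY: "\<Psi> (brk ?U X Y) = \<Phi> (e (n + 3))" "brk ?U X Y \<in> carr ?U"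
    and YY: "\<Psi> (brk ?U Y Y) = \<Phi> (e (n + 4))" "brk ?U Y Y \<in> carr ?U"
  proof -
    have "brk ?U (e (n + 1)) (e 1) = e (n + 2)" "brk ?U (e 1) (e (n + 1)) = e (n + 3)"
      "brk ?U (e (n + 1)) (e (n + 1)) = e (n + 4)"
      using n by (auto simp: fun_eq_iff bU e_def)
    then show "\<Psi> (brk ?U Y X) = \<Phi> (e (n + 2))" "brk ?U Y X \<in> carr ?U"
      "\<Psi> (brk ?U X Y) = \<Phi> (e (n + 3))" "brk ?U X Y \<in> carr ?U"
      "\<Psi> (brk ?U Y Y) = \<Phi> (e (n + 4))" "brk ?U Y Y \<in> carr ?U"
      using lift[OF Y(2) X(2) Y(1) X(1) e(2,1)] lift[OF X(2) Y(2) X(1) Y(1) e(1,2)]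
        lift[OF Y(2,2) Y(1,1) e(2,2)] by simp_all
  qed
  have en: "e n \<in> carr ?U" "e (n + 2) \<in> carr ?U" "e (n + 3) \<in> carr ?U" "e (n + 4) \<in> carr ?U"
    using n by (auto simp: e_def)
  have "c \<noteq> 0"
  proof
    assume "c = 0"
    then have "brk ?U X Y = 0" "brk ?U Y Y = 0"
      using n Y1 by (auto simp: fun_eq_iff bU c_def)
    then have "\<Phi> (e (n + 3)) = 0" "\<Phi> (e (n + 4)) = 0"
      using XY YY U.hom_zero[OF \<Psi>(1)] by simp_all
    then obtain u v where "e (n + 3) = u \<cdot> relation_vector n (p, q, r, s)"
      "e (n + 4) = v \<cdot> relation_vector n (p, q, r, s)"
      using \<Phi>(3) en by blast
    then have "e (n + 3) k = u * relation_vector n (p, q, r, s) k"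
      "e (n + 4) k = v * relation_vector n (p, q, r, s) k" for k
      by (simp_all add: scl_def)
    from this[of "n + 3"] this[of "n + 4"] show False
      by (auto simp: e_def relation_vector_def)
  qed
  define W where "W = p \<cdot> left_power ?U X (n - 1) + q \<cdot> brk ?U Y X + r \<cdot> brk ?U X Y + s \<cdot> brk ?U Y Y"
  have lp: "left_power ?U X (n - 1) \<in> carr ?U"
    using left_power_hom[OF U \<Psi>(1) X(1)] by blast
  have lin: "f (p \<cdot> A1 + q \<cdot> B1 + r \<cdot> C1 + s \<cdot> D1) = smul A p (f A1) + smul A q (f B1) +
      smul A r (f C1) + smul A s (f D1)"
    "p \<cdot> A1 + q \<cdot> B1 + r \<cdot> C1 + s \<cdot> D1 \<in> carr ?U"
    if "alg_hom ?U A f" "A1 \<in> carr ?U" "B1 \<in> carr ?U" "C1 \<in> carr ?U" "D1 \<in> carr ?U"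
    for f A1 B1 C1 D1
  proof -
    have sc: "u \<cdot> z \<in> carr ?U" "f (u \<cdot> z) = smul A u (f z)" if "z \<in> carr ?U" for u z
      using U.carr_closed(4)[OF that, of u] alg_homD(3)[OF \<open>alg_hom ?U A f\<close> that, of u] by simp_all
    show "p \<cdot> A1 + q \<cdot> B1 + r \<cdot> C1 + s \<cdot> D1 \<in> carr ?U"
      using that(2-5) by (intro U.carr_closed(2) sc)
    show "f (p \<cdot> A1 + q \<cdot> B1 + r \<cdot> C1 + s \<cdot> D1) = smul A p (f A1) + smul A q (f B1) +
      smul A r (f C1) + smul A s (f D1)"
      using that(2-5) sc
      by (simp del: universal_extension_sel add: alg_homD(2)[OF that(1)] U.carr_closed(2))
  qed
  have "W \<in> carr ?U" unfolding W_def by (rule lin(2)[OF \<Psi>(1) lp YX(2) XY(2) YY(2)])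
  moreover have "\<Psi> W = 0"
  proof -
    have "\<Psi> W = \<Phi> (p \<cdot> e n + q \<cdot> e (n + 2) + r \<cdot> e (n + 3) + s \<cdot> e (n + 4))"
      unfolding W_def lin(1)[OF \<Psi>(1) lp YX(2) XY(2) YY(2)] lin(1)[OF \<Phi>(1) en]
        top YX(1) XY(1) YY(1) ..
    also have "\<dots> = 0"
    proof -
      have "p \<cdot> e n + q \<cdot> e (n + 2) + r \<cdot> e (n + 3) + s \<cdot> e (n + 4) =
          1 \<cdot> relation_vector n (p, q, r, s)"
        by (auto simp: fun_eq_iff scl_def e_def relation_vector_def)
      then show ?thesis
        using \<Phi>(3)[OF lin(2)[OF \<Phi>(1) en]] by blast
    qed
    finally show ?thesis .
  qed
  ultimately obtain t where W: "W = t \<cdot> relation_vector n (p', q', r', s')"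
    using \<Psi>(3) by blast
  have Wk: "W k = p * (if k = n then a ^ n else 0) + q * brk ?U Y X k + r * brk ?U X Y k
      + s * brk ?U Y Y k" for k
    unfolding W_def left_power_top[OF n] by (simp add: scl_def e_def a_def)
  have "W n = p * a ^ n + q * a * d" "W (n + 2) = q * a * c" "W (n + 3) = r * a * c"
    "W (n + 4) = (q + r) * b * c + s * c\<^sup>2"
    using n Y1 unfolding Wk bU
    by (simp_all add: a_def b_def c_def d_def algebra_simps power2_eq_square)
  moreover have "W n = t * p'" "W (n + 2) = t * q'" "W (n + 3) = t * r'" "W (n + 4) = t * s'"
    unfolding W by (simp_all add: scl_def relation_vector_def)
  ultimately have "transform n a b c d (p, q, r, s) = (t * p', t * q', t * r', t * s')"
    by (simp add: transform_def)
  then show ?thesis using \<open>a \<noteq> 0\<close> \<open>c \<noteq> 0\<close> by blast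
qed

section \<open>Non-split extensions are quotients by a line\<close>

text \<open>
  Rank-nullity for \<open>m + 1\<close> vectors of rank \<open>m\<close>. It is phrased for a family, not for a set, since the
  vectors may coincide.
\<close>

lemma (in vector_space) linear_relations_line:
  assumes dim: "dim (v ` {..m}) = m"
  shows "\<exists>f. (\<exists>j\<le>m. f j \<noteq> 0) \<and>
    (\<forall>g. (\<Sum>i\<le>m. scale (g i) (v i)) = 0 \<longleftrightarrow> (\<exists>t. \<forall>i\<le>m. g i = t * f i))"
proof -
  define lc where "lc f = (\<Sum>i\<le>m. scale (f i) (v i))" for f
  have "\<exists>f. lc f = 0 \<and> (\<exists>j\<le>m. f j \<noteq> 0)"
  proof (rule ccontr)
    assume none: "\<not> ?thesis"
    have inj: "inj_on v {..m}"
    proof (rule inj_onI, rule ccontr)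
      fix i j assume ij: "i \<in> {..m}" "j \<in> {..m}" "v i = v j" "i \<noteq> j"
      \<comment> \<open>A repeated vector gives the relation \<open>v i - v j = 0\<close>.\<close>
      have "lc (\<lambda>k. if k = i then 1 else if k = j then - 1 else 0) =
          (\<Sum>k\<le>m. (if k = i then v i else 0) + (if k = j then - v j else 0))"
        unfolding lc_def using ij by (intro sum.cong) auto
      also have "\<dots> = 0"
        using ij by (simp add: sum.distrib)
      finally show False
        using none ij by fastforce
    qed
    have "\<forall>w\<in>v ` {..m}. u w = 0" if "(\<Sum>w\<in>v ` {..m}. scale (u w) w) = 0" for u
    proof -
      have "lc (u \<circ> v) = 0"
        using that inj by (simp add: sum.reindex lc_def)
      then show ?thesis using none by auto
    qed
    then have "independent (v ` {..m})"
      by (auto simp: dependent_finite)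
    then have "dim (v ` {..m}) = Suc m"
      using dim_eq_card_independent card_image[OF inj] by simp
    then show False using dim by simp
  qed
  then obtain f j where f: "lc f = 0" "j \<le> m" "f j \<noteq> 0" by blast
  have uniq: "\<exists>t. \<forall>i\<le>m. g i = t * f i" if g: "lc g = 0" for g
  proof -
    define h where "h = (\<lambda>i. g i - g j / f j * f i)"
    have "lc h = lc g - scale (g j / f j) (lc f)"
      by (simp add: h_def lc_def scale_left_diff_distrib sum_subtractf scale_sum_right)
    then have h: "lc h = 0" "h j = 0"
      using g f by (simp_all add: h_def)
    \<comment> \<open>In a relation, a vector with nonzero coefficient is spanned by the others with nonzero one.\<close>
    have solve: "v i \<in> span (v ` ({..m} - {i} - L))"
      if "lc k = 0" "i \<le> m" "k i \<noteq> 0" "\<And>l. l \<in> L \<Longrightarrow> k l = 0" for k i L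
    proof -
      have "lc k = scale (k i) (v i) + (\<Sum>l\<in>{..m} - {i}. scale (k l) (v l))"
        unfolding lc_def using that(2) by (intro sum.remove) auto
      also have "(\<Sum>l\<in>{..m} - {i}. scale (k l) (v l)) = (\<Sum>l\<in>{..m} - {i} - L. scale (k l) (v l))"
        using that(4) by (intro sum.mono_neutral_right) auto
      finally have "scale (k i) (v i) = - (\<Sum>l\<in>{..m} - {i} - L. scale (k l) (v l))"
        using that(1) by (simp add: eq_neg_iff_add_eq_0)
      moreover have "(\<Sum>l\<in>{..m} - {i} - L. scale (k l) (v l)) \<in> span (v ` ({..m} - {i} - L))"
        by (intro span_sum span_scale span_base) auto
      ultimately have "scale (k i) (v i) \<in> span (v ` ({..m} - {i} - L))"
        by (metis span_neg)
      then have "scale (inverse (k i)) (scale (k i) (v i)) \<in> span (v ` ({..m} - {i} - L))"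
        by (rule span_scale)
      then show ?thesis using that(3) by simp
    qed
    have "h i = 0" if "i \<le> m" for i
    proof (rule ccontr)
      \<comment> \<open>Otherwise \<open>v i\<close> and \<open>v j\<close> both lie in the span of the remaining \<open>m - 1\<close> vectors.\<close>
      assume i: "h i \<noteq> 0"
      then have "i \<noteq> j" using h by auto
      define W where "W = v ` ({..m} - {i} - {j})"
      have vi: "v i \<in> span W"
        unfolding W_def using solve[OF h(1) that i, of "{j}"] h(2) by blast
      have "{..m} - {j} = insert i ({..m} - {i} - {j})"
        using \<open>i \<noteq> j\<close> that by auto
      then have "v ` ({..m} - {j}) \<subseteq> insert (v i) W"
        unfolding W_def by (metis image_insert order_refl)
      then have "v ` ({..m} - {j}) \<subseteq> span W"
        using vi span_superset[of W] by (meson insert_subset order_trans)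
      then have "span (v ` ({..m} - {j})) \<subseteq> span W"
        by (intro span_minimal) auto
      then have vj: "v j \<in> span W"
        using solve[OF f(1,2,3), of "{}"] by auto
      have "v ` {..m} \<subseteq> span W"
      proof
        fix x assume "x \<in> v ` {..m}"
        then obtain k where "k \<le> m" "x = v k" by auto
        then show "x \<in> span W"
          using vi vj by (cases "k = i"; cases "k = j") (auto simp: W_def intro: span_base)
      qed
      moreover have "card ({..m} - {i} - {j}) < m"
        using \<open>i \<noteq> j\<close> that f(2) by simp
      then have "finite W" "card W < m"
        unfolding W_def using card_image_le[of "{..m} - {i} - {j}" v] by simp_all
      ultimately show False using dim_le_card[of "v ` {..m}" W] dim by simp
    qed
    then show ?thesis unfolding h_def by (intro exI[of _ "g j / f j"]) simp
  qed
  have "lc g = 0" if "\<forall>i\<le>m. g i = t * f i" for g t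
  proof -
    have "lc g = scale t (lc f)"
      using that by (simp add: lc_def scale_sum_right)
    then show ?thesis using f by simp
  qed
  then show ?thesis
    using f uniq unfolding lc_def by blast
qed

text \<open>
  Choose lifts \<open>x\<close>, \<open>y\<close> of the generators \<open>e 1\<close>, \<open>e 2\<close>. The Leibniz identity and centrality of the
  kernel determine all products of the left powers of \<open>x\<close> and of \<open>y\<close>: they are those of the universal
  extension, so the latter maps to \<open>E\<close>. The map is onto because \<open>E\<close> is non-split, and its kernel
  consists of the linear relations between the four central elements \<open>x\<^sup>n\<close>, \<open>[y, x]\<close>, \<open>[x, y]\<close>,
  \<open>[y, y]\<close>, which span the three-dimensional kernel of \<open>\<pi>\<close>.
\<close>

lemma nonsplit_extension_presented:
  fixes E :: "'a::ab_group_add calg"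
  assumes n: "n \<ge> 3" and ns: "nonsplit_extension 3 E (F2_algebra n)"
  shows "\<exists>\<rho>. \<rho> \<noteq> (0, 0, 0, 0) \<and> presented_by n E \<rho>"
proof -
  let ?U = "universal_extension n" and ?F = "F2_algebra n"
  note bF = brk_F2_algebra[OF n] and bU = brk_universal_extension[OF n]
  have ce: "central_extension 3 E ?F"
    using ns by (simp add: nonsplit_extension_def)
  then obtain \<pi> where E: "leibniz_algebra E"
    and \<pi>: "alg_hom E ?F \<pi>" "\<pi> ` carr E = carr ?F" "{x \<in> carr E. \<pi> x = 0} \<subseteq> alg_center E"
      "vector_space.dim (smul E) {x \<in> carr E. \<pi> x = 0} = 3"
    unfolding central_extension_iff by blast
  interpret E: leibniz_algebra E by (rule E)
  define K where "K = {x \<in> carr E. \<pi> x = 0}"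
  have KE: "x \<in> carr E" if "x \<in> K" for x using that by (simp add: K_def)
  have central: "brk E x y = 0" "brk E y x = 0" if "x \<in> K" "y \<in> carr E" for x y
    using \<pi>(3) that by (auto simp: alg_center_def K_def)
  have eF: "e 1 \<in> carr ?F" "e 2 \<in> carr ?F"
    using n by (auto simp: e_def)
  obtain x where x: "x \<in> carr E" "\<pi> x = e 1"
    using \<pi>(2) eF(1) by (metis imageE)
  obtain y where y: "y \<in> carr E" "\<pi> y = e 2"
    using \<pi>(2) eF(2) by (metis imageE)
  define P where "P k = left_power E x (k - 1)" for k
  have P1: "P 1 = x" and PS: "k \<ge> 1 \<Longrightarrow> P (Suc k) = brk E (P k) x" for k
    by (simp add: P_def) (cases k; simp add: P_def)
  have PE: "P k \<in> carr E" for k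
    using left_power_hom[OF E.fd_algebra_axioms \<pi>(1) x(1)] by (simp add: P_def)
  have P2: "\<pi> (P 2) = e 3"
    using PS[of 1] P1 by (auto simp: numeral_2_eq_2 alg_homD(4)[OF \<pi>(1) x(1) x(1)] x(2) fun_eq_iff bF e_def)
  have \<pi>P: "\<pi> (P k) = (if k < n then e (k + 1) else 0)" if "k \<ge> 2" for k
    using that
  proof (induction k rule: nat_induct_at_least)
    case base
    show ?case using P2 n by simp
  next
    case (Suc k)
    then have "\<pi> (P (Suc k)) = brk ?F (\<pi> (P k)) (e 1)"
      using PS[of k] alg_homD(4)[OF \<pi>(1) PE x(1)] x(2) by simp
    then show ?case
      using Suc by (auto simp: fun_eq_iff bF e_def)
  qed
  define B C D where "B = brk E y x" and "C = brk E x y" and "D = brk E y y"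
  have BCD: "B \<in> K" "C \<in> K" "D \<in> K"
    using x y by (auto simp: K_def B_def C_def D_def alg_homD(4)[OF \<pi>(1)] fun_eq_iff bF e_def)
  have PnK: "P k \<in> K" if "k \<ge> n" for k
    using \<pi>P[of k] PE n that by (simp add: K_def)
  have PP: "brk E z (P k) = 0" if "k \<ge> 2" "z \<in> carr E" for k z
    using that
  proof (induction k arbitrary: z rule: nat_induct_at_least)
    case base
    have "brk E z (brk E x x) = 0"
      using E.leibniz[OF base x(1) x(1)] by simp
    then show ?case using PS[of 1] P1 by (simp add: numeral_2_eq_2)
  next
    case (Suc k)
    then show ?case
      using PS[of k] E.leibniz[OF Suc.prems PE[of k] x(1)] x(1) by simp
  qed
  have Py: "brk E (P k) y = 0" if "k \<ge> 2" for k
    using that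
  proof (induction k rule: nat_induct_at_least)
    case base
    have "brk E (brk E x x) y = brk E (brk E x y) x"
      using E.leibniz[OF x(1) x(1) y(1)] central(2)[OF BCD(2) x(1)] by (simp add: C_def)
    also have "\<dots> = 0"
      using central(1)[OF BCD(2) x(1)] by (simp add: C_def)
    finally show ?case using PS[of 1] P1 by (simp add: numeral_2_eq_2)
  next
    case (Suc k)
    have "brk E (brk E (P k) x) y = 0"
      using E.leibniz[OF PE[of k] x(1) y(1)] central(2)[OF BCD(2) PE[of k]] Suc.IH x(1)
      by (simp add: C_def)
    then show ?case using PS[of k] Suc.hyps by simp
  qed
  define \<Phi> where "\<Phi> z = (\<Sum>k=1..n. smul E (z k) (P k)) + smul E (z (n + 1)) y
    + smul E (z (n + 2)) B + smul E (z (n + 3)) C + smul E (z (n + 4)) D" for z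
  note inE = PE x(1) y(1) BCD[THEN KE]
  have sumE: "(\<Sum>k\<in>I. smul E (f k) (P k)) \<in> carr E" for f I
    by (intro E.carr_sum) (simp add: PE)
  have \<Phi>E: "\<Phi> z \<in> carr E" for z
    by (simp add: \<Phi>_def sumE inE)
  have split1: "(\<Sum>k=1..n. f k) = f 1 + (\<Sum>k=2..n. f k)" for f :: "nat \<Rightarrow> 'a"
    using n by (simp add: sum.atLeast_Suc_atMost numeral_2_eq_2)
  have right: "brk E z (\<Phi> w) = smul E (w 1) (brk E z x) + smul E (w (n + 1)) (brk E z y)"
    if z: "z \<in> carr E" for z w
  proof -
    have "brk E z (\<Sum>k=1..n. smul E (w k) (P k)) = smul E (w 1) (brk E z x)"
      unfolding E.brk_sum(1)[OF z E.carr_closed(4)[OF PE]]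
      unfolding split1
      using z by (simp add: E.brk_smul_right inE PP P1[simplified])
    then show ?thesis
      using z by (simp add: \<Phi>_def E.brk_add_right E.brk_smul_right sumE inE central(2) BCD)
  qed
  have Pn: "brk E (P n) x = 0"
    using central(1)[OF PnK x(1)] by simp
  have left_x: "brk E (\<Phi> w) x = (\<Sum>k=2..n. smul E (w (k - 1)) (P k)) + smul E (w (n + 1)) B" for w
  proof -
    have "brk E (\<Sum>k=1..n. smul E (w k) (P k)) x = (\<Sum>k=1..n. smul E (w k) (brk E (P k) x))"
      unfolding E.brk_sum(2)[OF x(1) E.carr_closed(4)[OF PE]] by (simp add: E.brk_smul_left inE)
    also have "\<dots> = (\<Sum>k=1..n - 1. smul E (w k) (brk E (P k) x))"
      using n Pn by (cases n) simp_all
    also have "\<dots> = (\<Sum>k=1..n - 1. smul E (w (Suc k - 1)) (P (Suc k)))"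
      by (intro sum.cong) (simp_all add: PS)
    also have "\<dots> = (\<Sum>k=Suc 1..Suc (n - 1). smul E (w (k - 1)) (P k))"
      by (rule sum.shift_bounds_cl_Suc_ivl[symmetric])
    also have "\<dots> = (\<Sum>k=2..n. smul E (w (k - 1)) (P k))"
      using n by (simp add: numeral_2_eq_2)
    finally show ?thesis
      by (simp add: \<Phi>_def E.brk_add_left E.brk_smul_left sumE inE central(1) BCD B_def[symmetric])
  qed
  have left_y: "brk E (\<Phi> w) y = smul E (w 1) C + smul E (w (n + 1)) D" for w
  proof -
    have "brk E (\<Sum>k=1..n. smul E (w k) (P k)) y = smul E (w 1) C"
      unfolding E.brk_sum(2)[OF y(1) E.carr_closed(4)[OF PE]]
      unfolding split1
      by (simp add: E.brk_smul_left inE Py P1[simplified] C_def[symmetric])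
    then show ?thesis
      by (simp add: \<Phi>_def E.brk_add_left E.brk_smul_left sumE inE central(1) BCD D_def[symmetric])
  qed
  have \<Phi>_add: "\<Phi> (z + w) = \<Phi> z + \<Phi> w" and \<Phi>_scale: "\<Phi> (c \<cdot> z) = smul E c (\<Phi> z)" for z w c
    by (simp_all add: \<Phi>_def scl_def E.scale_left_distrib E.scale_right_distrib sum.distrib
        E.scale_sum_right)
  have \<Phi>_brk: "\<Phi> (brk ?U z w) = brk E (\<Phi> z) (\<Phi> w)" for z w
  proof -
    have "\<Phi> (brk ?U z w) = (\<Sum>k=2..n. smul E (z (k - 1) * w 1) (P k)) + smul E (z (n + 1) * w 1) B
        + smul E (z 1 * w (n + 1)) C + smul E (z (n + 1) * w (n + 1)) D"
      unfolding \<Phi>_def split1 using n by (simp add: bU)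
    also have "\<dots> = smul E (w 1) ((\<Sum>k=2..n. smul E (z (k - 1)) (P k)) + smul E (z (n + 1)) B) +
        smul E (w (n + 1)) (smul E (z 1) C + smul E (z (n + 1)) D)"
      by (simp add: E.scale_right_distrib E.scale_sum_right mult.commute add.assoc)
    finally show ?thesis
      unfolding right[OF \<Phi>E] left_x left_y .
  qed
  have hom: "alg_hom ?U E \<Phi>"
    unfolding alg_hom_def by (auto simp: \<Phi>E \<Phi>_add \<Phi>_scale \<Phi>_brk)
  have \<pi>_K: "\<pi> z = 0" if "z \<in> K" for z using that by (simp add: K_def)
  have \<pi>_scale: "\<pi> (smul E c z) = c \<cdot> \<pi> z" if "z \<in> carr E" for c z
    using alg_homD(3)[OF \<pi>(1) that] by simp
  have \<pi>\<Phi>: "\<pi> (\<Phi> z) = (\<lambda>j. if j = 1 then z 1 else if j = 2 then z (n + 1)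
      else if 3 \<le> j \<and> j \<le> n then z (j - 1) else 0)" for z
  proof
    fix j
    have "\<pi> (\<Phi> z) = (\<Sum>k=1..n. z k \<cdot> \<pi> (P k)) + z (n + 1) \<cdot> e 2"
      by (simp add: \<Phi>_def alg_homD(2)[OF \<pi>(1)] \<pi>_scale sumE inE \<pi>_K BCD y(2)
          E.hom_sum[OF \<pi>(1)] scl_def fun_eq_iff)
    also have "(\<Sum>k=1..n. z k \<cdot> \<pi> (P k)) =
        z 1 \<cdot> e 1 + (\<Sum>k=2..n. z k \<cdot> (if k < n then e (k + 1) else 0))"
      using n by (simp add: sum.atLeast_Suc_atMost numeral_2_eq_2 P1[simplified] x(2) \<pi>P)
    finally have "\<pi> (\<Phi> z) j = z 1 * e 1 j + (\<Sum>k=2..n. z k * (if k < n then e (k + 1) else 0) j)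
        + z (n + 1) * e 2 j"
      by (simp add: scl_def sum_fun_eval)
    also have "(\<Sum>k=2..n. z k * (if k < n then e (k + 1) else 0) j) =
        (\<Sum>k=2..n. if k = j - 1 then (if 3 \<le> j \<and> j \<le> n then z (j - 1) else 0) else 0)"
      by (intro sum.cong) (auto simp: e_def)
    also have "\<dots> = (if 3 \<le> j \<and> j \<le> n then z (j - 1) else 0)"
      by (simp add: sum.delta) (use n in auto)
    finally show "\<pi> (\<Phi> z) j = (if j = 1 then z 1 else if j = 2 then z (n + 1)
      else if 3 \<le> j \<and> j \<le> n then z (j - 1) else 0)"
      by (auto simp: e_def)
  qed
  \<comment> \<open>The coordinates of \<open>F2_algebra n\<close> are shifted: the power \<open>P k\<close> maps to \<open>e (k + 1)\<close> for \<open>2 \<le> k < n\<close>.\<close>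
  have onto_F: "\<exists>z\<in>carr ?U. \<pi> (\<Phi> z) = w" if w: "w \<in> carr ?F" for w
  proof
    define z where "z = (\<lambda>k. if k = 1 then w 1 else if k = n + 1 then w 2
      else if 2 \<le> k \<and> k < n then w (k + 1) else 0)"
    show "z \<in> carr ?U" using n by (auto simp: z_def)
    have w0: "w j = 0" if "j = 0 \<or> j > n" for j using w that by auto
    show "\<pi> (\<Phi> z) = w"
      unfolding \<pi>\<Phi> fun_eq_iff z_def using n by (auto simp: w0 not_le)
  qed
  define S where "S = \<Phi> ` carr ?U"
  have "S = carr E"
  proof (rule nonsplit_extension_generated[OF ns \<pi>(1,3,4)])
    have "0 \<in> S"
      unfolding S_def by (rule image_eqI[of _ _ 0]) (simp_all add: \<Phi>_def)
    then show "E.subspace S"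
      unfolding E.subspace_def S_def
      using E.carr_closed
      by (auto simp: \<Phi>_add[symmetric] \<Phi>_scale[symmetric] scl_def intro!: imageI)
    show "S \<subseteq> carr E" using \<Phi>E by (auto simp: S_def)
    show "\<pi> ` S = carr ?F"
    proof
      show "\<pi> ` S \<subseteq> carr ?F" using alg_homD(1)[OF \<pi>(1) \<Phi>E] by (auto simp: S_def)
      show "carr ?F \<subseteq> \<pi> ` S" using onto_F unfolding S_def by blast
    qed
    fix u v assume uv: "u \<in> carr E" "v \<in> carr E"
    obtain z where z: "z \<in> carr ?U" "\<pi> (\<Phi> z) = \<pi> u"
      using onto_F[OF alg_homD(1)[OF \<pi>(1) uv(1)]] by blast
    obtain w where w: "w \<in> carr ?U" "\<pi> (\<Phi> w) = \<pi> v"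
      using onto_F[OF alg_homD(1)[OF \<pi>(1) uv(2)]] by blast
    have k: "u - \<Phi> z \<in> K" "v - \<Phi> w \<in> K"
      using z w uv by (auto simp: K_def E.hom_diff[OF \<pi>(1)] \<Phi>E)
    have "brk E (l + a) (m + b) = brk E a b"
      if "a \<in> carr E" "b \<in> carr E" "l \<in> K" "m \<in> K" for a b l m
      using that KE by (simp add: E.brk_add_left E.brk_add_right central)
    from this[OF \<Phi>E[of z] \<Phi>E[of w] k] have "brk E u v = brk E (\<Phi> z) (\<Phi> w)" by simp
    then show "brk E u v \<in> S"
      unfolding S_def using z(1) w(1) \<Phi>_brk[of z w]
        fd_algebra.brk_closed[OF fd_algebra_universal_extension[OF n]] by (metis imageI)
  qed
  have \<Phi>_K: "\<Phi> z = smul E (z n) (P n) + smul E (z (n + 2)) B + smul E (z (n + 3)) C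
      + smul E (z (n + 4)) D" if z: "\<And>k. k < n \<Longrightarrow> z k = 0" "z (n + 1) = 0" for z
  proof -
    have "(\<Sum>k=1..n. smul E (z k) (P k)) = (\<Sum>k\<in>{n}. smul E (z k) (P k))"
      using n z by (intro sum.mono_neutral_right) auto
    then show ?thesis using z by (simp add: \<Phi>_def)
  qed
  have ker: "z k = 0" if "z \<in> carr ?U" "\<pi> (\<Phi> z) = 0" "k < n \<or> k = n + 1" for z k
  proof -
    have 0: "\<pi> (\<Phi> z) j = 0" for j using that(2) by simp
    have "z 0 = 0" "z 1 = 0" "z (n + 1) = 0"
      using 0[of 1] 0[of 2] that(1) unfolding \<pi>\<Phi> by simp_all
    moreover have "z k = 0" if "2 \<le> k" "k < n"
      using 0[of "k + 1"] that unfolding \<pi>\<Phi> by simp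
    ultimately show ?thesis
      using that(3) by (cases "k = 0"; cases "k = 1") auto
  qed
  define v where "v i = (if i = 0 then P n else if i = 1 then B else if i = 2 then C else D)" for i :: nat
  have le3: "{..3::nat} = {0, 1, 2, 3}" by auto
  have comb: "(\<Sum>i\<le>3. smul E (g i) (v i)) =
      smul E (g 0) (P n) + smul E (g 1) B + smul E (g 2) C + smul E (g 3) D" for g
    by (simp add: le3 v_def add.assoc)
  have subK: "E.subspace K"
    unfolding E.subspace_def K_def
    by (auto simp: E.hom_zero[OF \<pi>(1)] alg_homD(2)[OF \<pi>(1)] \<pi>_scale scl_def fun_eq_iff)
  have "E.span (v ` {..3}) = K"
  proof
    show "E.span (v ` {..3}) \<subseteq> K"
      using BCD PnK[of n] by (intro E.span_minimal subK) (auto simp: v_def)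
    show "K \<subseteq> E.span (v ` {..3})"
    proof
      fix a assume a: "a \<in> K"
      then obtain z where z: "z \<in> carr ?U" "a = \<Phi> z"
        using \<open>S = carr E\<close> KE unfolding S_def by blast
      define g where "g i = (if i = 0 then z n else if i = 1 then z (n + 2)
      else if i = 2 then z (n + 3) else z (n + 4))" for i :: nat
      have "a = smul E (z n) (P n) + smul E (z (n + 2)) B + smul E (z (n + 3)) C + smul E (z (n + 4)) D"
        unfolding z(2) using ker[OF z(1)] \<pi>_K[OF a] z(2) by (intro \<Phi>_K) simp_all
      also have "\<dots> = (\<Sum>i\<le>3. smul E (g i) (v i))"
        by (simp add: comb g_def)
      also have "\<dots> \<in> E.span (v ` {..3})"
        by (intro E.span_sum E.span_scale E.span_base) simp
      finally show "a \<in> E.span (v ` {..3})" .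
    qed
  qed
  then have dim3: "E.dim (v ` {..3}) = 3"
    using \<pi>(4) E.dim_span[of "v ` {..3}"] by (simp add: K_def)
  obtain f where f: "(\<exists>j\<le>3. f j \<noteq> 0) \<and>
      (\<forall>g. (\<Sum>i\<le>3. smul E (g i) (v i)) = 0 \<longleftrightarrow> (\<exists>t. \<forall>i\<le>3. g i = t * f i))"
    using E.linear_relations_line[OF dim3] by (rule exE)
  note f = f[THEN conjunct1] f[THEN conjunct2, rule_format]
  define \<rho> where "\<rho> = (f 0, f 1, f 2, f 3)"
  have all4: "(\<forall>i\<le>3. Q i) \<longleftrightarrow> Q 0 \<and> Q 1 \<and> Q 2 \<and> Q (3::nat)" for Q
    using le3 by (metis atMost_iff insert_iff singletonD)
  have "\<Phi> z = 0 \<longleftrightarrow> (\<exists>t. z = t \<cdot> relation_vector n \<rho>)" if z: "z \<in> carr ?U" for z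
  proof -
    define g where "g i = (if i = 0 then z n else if i = 1 then z (n + 2)
      else if i = 2 then z (n + 3) else z (n + 4))" for i :: nat
    have g: "(\<forall>i\<le>3. g i = t * f i) \<longleftrightarrow> z n = t * f 0 \<and> z (n + 2) = t * f 1 \<and> z (n + 3) = t * f 2
        \<and> z (n + 4) = t * f 3" for t
      unfolding all4 by (simp add: g_def)
    show ?thesis
    proof
      assume 0: "\<Phi> z = 0"
      then have low: "z k = 0" if "k < n \<or> k = n + 1" for k
        using ker[OF z _ that] E.hom_zero[OF \<pi>(1)] by simp
      then have "(\<Sum>i\<le>3. smul E (g i) (v i)) = 0"
        using 0 \<Phi>_K[of z] by (simp add: comb g_def)
      then obtain t where "\<forall>i\<le>3. g i = t * f i" using f(2) by blast
      then have t: "z n = t * f 0" "z (n + 2) = t * f 1" "z (n + 3) = t * f 2" "z (n + 4) = t * f 3"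
        unfolding g by simp_all
      have high: "z k = 0" if "k > n + 4" for k using z that by simp
      have "z k = (t \<cdot> relation_vector n \<rho>) k" for k
      proof -
        consider "k < n \<or> k = n + 1" | "k = n" | "k = n + 2" | "k = n + 3" | "k = n + 4" | "k > n + 4"
          by linarith
        then show ?thesis
          by cases (auto simp: low high t t(2)[simplified] scl_def relation_vector_def \<rho>_def)
      qed
      then show "\<exists>t. z = t \<cdot> relation_vector n \<rho>" by blast
    next
      assume "\<exists>t. z = t \<cdot> relation_vector n \<rho>"
      then obtain t where t: "z = t \<cdot> relation_vector n \<rho>" by blast
      have zs: "z n = t * f 0" "z (n + 2) = t * f 1" "z (n + 3) = t * f 2" "z (n + 4) = t * f 3"
        "\<And>k. k < n \<Longrightarrow> z k = 0" "z (n + 1) = 0"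
        by (simp_all add: t scl_def relation_vector_def \<rho>_def)
      then have "(\<Sum>i\<le>3. smul E (g i) (v i)) = 0"
        unfolding f(2) g by blast
      then show "\<Phi> z = 0"
        using \<Phi>_K[of z] zs(5,6) by (simp add: comb g_def)
    qed
  qed
  then have "presented_by n E \<rho>"
    unfolding presented_by_def using hom \<open>S = carr E\<close> unfolding S_def by metis
  moreover have "\<rho> \<noteq> (0, 0, 0, 0)"
    using f(1) all4[of "\<lambda>i. f i = 0"] by (auto simp: \<rho>_def)
  ultimately show ?thesis by blast
qed

theorem theorem4p7:
  fixes n :: nat
  assumes "n \<ge> 3"
  shows "(\<forall>E :: 'a::ab_group_add calg. nonsplit_extension 3 E (F2_algebra n) \<longrightarrow>
            (\<exists>p\<in>Q_params. E \<simeq> Q_algebra n p) \<or> E \<simeq> Q_star n)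
       \<and> (\<forall>p\<in>Q_params. \<forall>q\<in>Q_params. p \<noteq> q \<longrightarrow> \<not> Q_algebra n p \<simeq> Q_algebra n q)
       \<and> (\<forall>p\<in>Q_params. \<not> Q_algebra n p \<simeq> Q_star n)"
proof (intro conjI allI impI ballI notI)
  have presQ: "presented_by n (Q_algebra n \<rho>) (Q_relation \<rho>)" if "\<rho> \<in> Q_params" for \<rho>
  proof -
    obtain \<alpha>4 \<beta>3 \<beta>4 \<gamma>3 \<gamma>4 where \<rho>: "\<rho> = (\<alpha>4, \<beta>3, \<beta>4, \<gamma>3, \<gamma>4)" by (cases \<rho>)
    then have "\<gamma>3 \<noteq> 0 \<or> \<gamma>4 \<noteq> 0" using that by (auto simp: Q_params_def)
    then show ?thesis unfolding \<rho> by (rule presented_by_Q_algebra[OF assms])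
  qed
  \<comment> \<open>So the left power \<open>x\<^sup>n\<close> is nonzero in all \<open>Q\<close>-algebras, and zero in \<open>Q_star\<close>.\<close>
  have not_top: "(q, r, s) \<noteq> (0, 0, 0)" if "\<rho> \<in> Q_params" "Q_relation \<rho> = (p, q, r, s)" for \<rho> p q r s
    using that by (auto simp: Q_params_def Q_relation_def)
  {
    fix E :: "'a calg" assume "nonsplit_extension 3 E (F2_algebra n)"
    then obtain p q r s where nz: "(p, q, r, s) \<noteq> (0, 0, 0, 0)" and E: "presented_by n E (p, q, r, s)"
      using nonsplit_extension_presented[OF assms] by (metis surj_pair)
    show "(\<exists>p\<in>Q_params. E \<simeq> Q_algebra n p) \<or> E \<simeq> Q_star n"
    proof (cases "(q, r, s) = (0, 0, 0)")
      case True
      have "presented_by n E (1, 0, 0, 0)"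
        using True nz
        by (intro presented_by_transform[OF assms E, of 1 1 "1 / p" 0 0]) (auto simp: transform_def)
      then show ?thesis
        using presented_by_unique[OF assms _ presented_by_Q_star[OF assms]] by blast
    next
      case False
      then obtain \<rho> b c d t where \<rho>: "\<rho> \<in> Q_params" and "c \<noteq> 0" "t \<noteq> 0"
        "transform n 1 b c d (Q_relation \<rho>) = (t * p, t * q, t * r, t * s)"
        using transform_normal_form[OF False, of n p] by metis
      then have "presented_by n E (Q_relation \<rho>)"
        using presented_by_transform[OF assms E, of 1 c t b d] by simp
      then show ?thesis
        using presented_by_unique[OF assms _ presQ[OF \<rho>]] \<rho> by blast
    qed
  }
  {
    fix \<rho> \<sigma> assume \<rho>\<sigma>: "\<rho> \<in> Q_params" "\<sigma> \<in> Q_params" "\<rho> \<noteq> \<sigma>" "Q_algebra n \<rho> \<simeq> Q_algebra n \<sigma>"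
    obtain p q r s where \<rho>: "Q_relation \<rho> = (p, q, r, s)" by (metis surj_pair)
    obtain p' q' r' s' where \<sigma>: "Q_relation \<sigma> = (p', q', r', s')" by (metis surj_pair)
    have "presented_by n (Q_algebra n \<sigma>) (Q_relation \<rho>)"
      using presented_by_iso[OF assms presQ[OF \<rho>\<sigma>(1)] \<rho>\<sigma>(4)] .
    then obtain a b c d t where "a \<noteq> 0" "c \<noteq> 0"
      "transform n a b c d (Q_relation \<rho>) = (t * p', t * q', t * r', t * s')"
      using presented_by_transform_exists[OF assms _ presQ[OF \<rho>\<sigma>(2), unfolded \<sigma>]
          not_top[OF \<rho>\<sigma>(1) \<rho>] not_top[OF \<rho>\<sigma>(2) \<sigma>]] \<rho> by metis
    then show False
      using transform_Q_relation_unique[OF \<rho>\<sigma>(1,2) _ _ \<sigma>] \<rho>\<sigma>(3) by metis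
  }
  {
    fix \<rho> assume \<rho>: "\<rho> \<in> Q_params" "Q_algebra n \<rho> \<simeq> Q_star n"
    obtain p q r s where rel: "Q_relation \<rho> = (p, q, r, s)" by (metis surj_pair)
    have "presented_by n (Q_star n) (p, q, r, s)"
      using presented_by_iso[OF assms presQ[OF \<rho>(1)] \<rho>(2)] rel by simp
    then show False
      using presented_by_top_power_relation[OF assms presented_by_Q_star[OF assms]] not_top[OF \<rho>(1) rel]
      by blast
  }
qed

end
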